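(* There is an absolute constant $c>0$ such that the following holds for every $n\in\mathbb{N}$ and every $M$ as described. Let $M$ be a strictly convex, twice differentiable Orlicz function that is strictly 2-concave. Assume that $M^*(1)=1$, and let, for $l=1,2,\dots,n$, $$ a_l=n\int_{\frac{l-1}{n}}^{\frac{l}{n}}\left\{-\frac12\int_t^1\frac{\big(({M^*}^{-1})^2\big)''(s)}{\sqrt{({M^*}^{-1})^2(s)-s\,\big(({M^*}^{-1})^2\big)'(s)}}\,ds+1-\sqrt{1-\big(({M^*}^{-1})^2\big)'(1)}\right\}dt . $$ Then for all $x=(x_1,\dots,x_n)\in\mathbb{R}^n$ $$ \frac1c\,\|x\|_M\;\le\;\frac1{n!}\sum_{\pi}\Big(\sum_{i=1}^n|x_ia_{\pi(i)}|^2\Big)^{1/2}\;\le\;c\,\|x\|_M, $$ where the outer sum runs over all permutations $\pi$ of $\{1,\dots,n\}$. (The constant $c$ does not depend on $n$ and $M$.)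
   Context: An Orlicz function is a convex function $M:\mathbb{R}\to\mathbb{R}$ with $M(t)=M(-t)$, $M(0)=0$, and $M(t)>0$ for $t\ne0$. It is strictly 2-concave if $t\mapsto M(\sqrt t)$ is strictly concave on $[0,\infty)$. If $M'$ is invertible on $(0,\infty)$, the dual function is $M^*(t)=\int_0^t{M'}^{-1}(s)\,ds$ for $t\ge0$, extended evenly (equivalently $M^*(t)=\sup_s(st-M(s))$). ${M^*}^{-1}$ denotes the inverse of $M^*$ restricted to $[0,\infty)$, and $({M^*}^{-1})^2$ is its pointwise square $s\mapsto({M^*}^{-1}(s))^2$. The Orlicz norm of $x\in\mathbb{R}^n$ (regarded as a sequence by adding zeros) is $$\|x\|_M=\sup\Big\{\sum_i x_iy_i \;:\; \sum_i M^*(y_i)\le 1\Big\}.$$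
   Formalization: It is additionally assumed that M''(t) is nonzero for almost every t>0 with M'(t)<1; otherwise the second derivative of the squared inverse of M* in the formula for a_l fails to exist or misses a singular part of the first derivative, and no absolute constant c works. *)

theory Defs
  imports "HOL-Analysis.Analysis" "HOL-Combinatorics.Permutations"
begin

definition strictly_convex_on :: "'a::real_vector set \<Rightarrow> ('a \<Rightarrow> real) \<Rightarrow> bool" where
  "strictly_convex_on S f \<longleftrightarrow> convex S \<and>
     (\<forall>x\<in>S. \<forall>y\<in>S. \<forall>u>0. \<forall>v>0. x \<noteq> y \<longrightarrow> u + v = 1 \<longrightarrow>
        f (u *\<^sub>R x + v *\<^sub>R y) < u * f x + v * f y)"

definition strictly_concave_on :: "'a::real_vector set \<Rightarrow> ('a \<Rightarrow> real) \<Rightarrow> bool" where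
  "strictly_concave_on S f \<longleftrightarrow> strictly_convex_on S (\<lambda>x. - f x)"

definition orlicz_function :: "(real \<Rightarrow> real) \<Rightarrow> bool" where
  "orlicz_function M \<longleftrightarrow> convex_on UNIV M \<and> (\<forall>t. M (- t) = M t) \<and> M 0 = 0 \<and> (\<forall>t. t \<noteq> 0 \<longrightarrow> M t > 0)"

definition strictly_2_concave :: "(real \<Rightarrow> real) \<Rightarrow> bool" where
  "strictly_2_concave M \<longleftrightarrow> strictly_concave_on {0..} (\<lambda>t. M (sqrt t))"

definition twice_differentiable :: "(real \<Rightarrow> real) \<Rightarrow> bool" where
  "twice_differentiable M \<longleftrightarrow>
     (\<forall>t. M differentiable (at t)) \<and> (\<forall>t. deriv M differentiable (at t))"

(* M' restricted to (0,oo) need not be onto (0,oo); it may be bounded, as for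
   M(t) = sqrt(1 + t^2) - 1. Its inverse is then oo beyond the supremum of M', in accordance
   with M*(t) = sup_s (s t - M(s)). The points s \<le> 0, where the inverse is also given the value
   oo, do not contribute to the integral in orlicz_dual (when M'(0) = 0). *)
definition inverse_deriv :: "(real \<Rightarrow> real) \<Rightarrow> real \<Rightarrow> ennreal" where
  "inverse_deriv M s =
     (if s \<in> deriv M ` {0<..} then ennreal (inv_into {0<..} (deriv M) s) else \<infinity>)"

definition orlicz_dual :: "(real \<Rightarrow> real) \<Rightarrow> real \<Rightarrow> ennreal" where
  "orlicz_dual M t = (\<integral>\<^sup>+ s\<in>{0..\<bar>t\<bar>}. inverse_deriv M s \<partial>lborel)"

definition dual_inv :: "(real \<Rightarrow> real) \<Rightarrow> real \<Rightarrow> real" where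
  "dual_inv M s = inv_into {0..} (orlicz_dual M) (ennreal s)"

definition dual_inv_sq :: "(real \<Rightarrow> real) \<Rightarrow> real \<Rightarrow> real" where
  "dual_inv_sq M s = (dual_inv M s)\<^sup>2"

definition orlicz_norm :: "(real \<Rightarrow> real) \<Rightarrow> (nat \<Rightarrow> real) \<Rightarrow> real" where
  "orlicz_norm M x = (SUP y\<in>{y. (\<Sum>i. orlicz_dual M (y i)) \<le> 1}. \<Sum>i. x i * y i)"

(* A vector (x_1,...,x_n) as a sequence; index 0 also carries a zero. *)
definition zero_extend :: "nat \<Rightarrow> (nat \<Rightarrow> real) \<Rightarrow> nat \<Rightarrow> real" where
  "zero_extend n x = (\<lambda>i. if i \<in> {1..n} then x i else 0)"

(* The derivative at 1 is the one from the left: if M* is oo on (1,oo), then the inverse of M*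
   is defined on [0,1] only. Otherwise it agrees with the two-sided derivative. *)
definition coef_integrand :: "(real \<Rightarrow> real) \<Rightarrow> real \<Rightarrow> real" where
  "coef_integrand M t =
     (let f = dual_inv_sq M in
        - (1/2) * integral {t..1} (\<lambda>s. deriv (deriv f) s / sqrt (f s - s * deriv f s))
        + 1 - sqrt (1 - vector_derivative f (at 1 within {0..1})))"

definition coef :: "(real \<Rightarrow> real) \<Rightarrow> nat \<Rightarrow> nat \<Rightarrow> real" where
  "coef M n l = real n * integral {(real l - 1) / real n..real l / real n} (coef_integrand M)"

(* The condition under which the second derivative of f = (M*^{-1})^2 in the formula for the
   coefficients makes sense. The substitution s = M*(y), y = M'(t) maps
   {t > 0. M'(t) < 1} onto (0,1) if M*(1) = 1, and f is twice differentiable at s iff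
   M''(t) \<noteq> 0. Under the condition, f'' exists almost everywhere and f' is its indefinite
   integral; if M'' vanishes on a set of positive measure (which strict convexity allows), then
   f' has a singular part, which f'' does not see. *)
definition dual_inv_sq_regular :: "(real \<Rightarrow> real) \<Rightarrow> bool" where
  "dual_inv_sq_regular M \<longleftrightarrow>
     (AE t in lborel. 0 < t \<and> deriv M t < 1 \<longrightarrow> deriv (deriv M) t \<noteq> 0)"

end

theory Submission
  imports Defs
begin

text \<open>
  Put \<open>f = (M*\<^sup>-\<^sup>1)\<^sup>2\<close>, \<open>h(s) = sqrt (f(s) - s f'(s))\<close>, and let \<open>a\<close> be the function averaged in the
  definition of the coefficients. Since \<open>(f - s f')' = - s f''\<close>, we have
  \<open>a(t) = \<integral>\<^sub>t\<^sup>1 h'(s)/s ds + 1 - h(1)\<close>, so \<open>a\<close> is decreasing with \<open>P(t) := \<integral>\<^sub>0\<^sup>t a = t a(t) + h(t)\<close>.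
  With \<open>Q(t) := \<integral>\<^sub>t\<^sup>1 a\<^sup>2\<close>, the functions \<open>f(t)/t\<close> and \<open>P(t)\<^sup>2/t + Q(t)\<close> have the same derivative
  \<open>- (h(t)/t)\<^sup>2\<close> and agree at 1, whence \<open>f = P\<^sup>2 + t Q\<close>.

  The Orlicz norm is the supremum of \<open>\<Sum> x\<^sub>i sqrt (f(s\<^sub>i))\<close> over \<open>s\<^sub>i \<ge> 0\<close>, \<open>\<Sum> s\<^sub>i \<le> 1\<close>. It is bounded by the
  permutation average through random test vectors in the Euclidean unit ball, which pick up the
  part \<open>P(s\<^sub>i)\<close> or the part \<open>sqrt (s\<^sub>i Q(s\<^sub>i))\<close>. Conversely, the entries \<open>x\<^sub>i a\<^sub>j\<close> are split at twice the
  Orlicz norm; the large ones are estimated in \<open>\<ell>\<^sub>1\<close>, the small ones in \<open>\<ell>\<^sub>2\<close>.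
\<close>

section \<open>Averages over permutations\<close>

text \<open>The formula for \<open>a\<close> arises from solving \<open>f = P\<^sup>2 + t Q\<close>.
  The derivative of \<open>P\<^sup>2/t + Q\<close> is \<open>- ((P - t a)/t)\<^sup>2\<close>, and
  \<open>P - t a\<close> is nonnegative for decreasing \<open>a\<close>; so agreement with
  \<open>f/t\<close> forces \<open>P - t a = h\<close>, that is \<open>h' = - t a'\<close>, and
  \<open>P(1) = 1\<close> forces \<open>a(1) = 1 - h(1)\<close>. The two summands are the two
  regimes of the average: \<open>P\<close> measures the largest coefficients, which act through an
  l1 sum, \<open>t Q\<close> the others, which act through an l2 sum. Strict 2-concavity makes
  \<open>M'(t)/t\<close> decrease; as \<open>f'(s) = 2 M'(t)/t\<close> for
  \<open>s = M*(M'(t))\<close>, it makes \<open>f\<close> concave and \<open>h\<close> increasing.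
  The analytic obstacle is that \<open>M''\<close> may vanish on a null set. At the corresponding
  \<open>s\<close> there is no \<open>f''\<close>, and \<open>h\<close> is neither differentiable
  nor evidently absolutely continuous. The regularity assumption is exploited in the variable
  \<open>t\<close>, where all functions are differentiable: the exceptional \<open>s\<close> and
  their images under \<open>h\<close> form null sets, so no growth of \<open>h\<close> is lost when
  \<open>h'\<close> is integrated. Rounding to the grid costs \<open>1/n\<close> for each of
  \<open>n\<close> coordinates, hence only a constant factor.\<close>

text \<open>A permutation of \<open>S\<close> is a transposition of \<open>i\<close> and
  \<open>b\<close> after a permutation of \<open>S - {i}\<close>, and its value at \<open>i\<close>
  is \<open>b\<close>; so each value is taken equally often.\<close>

lemma sum_permutations_eval:
  fixes F :: "'a \<Rightarrow> real"
  assumes "finite S" "i \<in> S"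
  shows "(\<Sum>\<pi> | \<pi> permutes S. F (\<pi> i)) = fact (card S - 1) * sum F S"
proof -
  let ?T = "S - {i}"
  have S: "S = insert i ?T" using assms by auto
  have "(\<Sum>\<pi> | \<pi> permutes insert i ?T. F (\<pi> i)) =
      (\<Sum>b\<in>insert i ?T. \<Sum>q | q permutes ?T. F ((Transposition.transpose i b \<circ> q) i))"
    by (rule sum_over_permutations_insert) (use assms in auto)
  also have "\<dots> = (\<Sum>b\<in>insert i ?T. \<Sum>q | q permutes ?T. F b)"
    by (intro sum.cong refl) (auto simp: permutes_not_in)
  also have "\<dots> = fact (card S - 1) * sum F S"
    using assms S by (simp add: card_permutations[of ?T "card S - 1"] sum_distrib_left)
  finally show ?thesis unfolding S[symmetric] .
qed

text \<open>Once \<open>\<pi> i = b\<close> is fixed, \<open>\<pi> j\<close> is uniform on the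
  remaining values. Adding the missing term \<open>H b\<close> decouples the two sums; nonnegativity
  makes this an upper bound.\<close>

lemma sum_permutations_eval2_le:
  fixes F H :: "'a \<Rightarrow> real"
  assumes fin: "finite S" and ij: "i \<in> S" "j \<in> S" "i \<noteq> j"
    and F: "\<And>l. l \<in> S \<Longrightarrow> 0 \<le> F l" and H: "\<And>l. l \<in> S \<Longrightarrow> 0 \<le> H l"
  shows "(\<Sum>\<pi> | \<pi> permutes S. F (\<pi> i) * H (\<pi> j)) \<le> fact (card S - 2) * (sum F S * sum H S)"
proof -
  let ?T = "S - {i}"
  have S: "S = insert i ?T" using ij by auto
  have "(\<Sum>\<pi> | \<pi> permutes insert i ?T. F (\<pi> i) * H (\<pi> j)) =
      (\<Sum>b\<in>insert i ?T. \<Sum>q | q permutes ?T.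
         F ((Transposition.transpose i b \<circ> q) i) * H ((Transposition.transpose i b \<circ> q) j))"
    by (rule sum_over_permutations_insert) (use fin in auto)
  also have "\<dots> = (\<Sum>b\<in>insert i ?T. F b * (\<Sum>q | q permutes ?T. H (Transposition.transpose i b (q j))))"
    by (intro sum.cong refl) (auto simp: permutes_not_in sum_distrib_left)
  also have "\<dots> \<le> (\<Sum>b\<in>insert i ?T. F b * (fact (card S - 2) * sum H S))"
  proof (intro sum_mono mult_left_mono)
    fix b assume b: "b \<in> insert i ?T"
    have "(\<Sum>q | q permutes ?T. H (Transposition.transpose i b (q j)))
        = fact (card ?T - 1) * (\<Sum>l\<in>?T. H (Transposition.transpose i b l))"
      using sum_permutations_eval[of ?T j "\<lambda>l. H (Transposition.transpose i b l)"] fin ij by simp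
    also have "(\<Sum>l\<in>?T. H (Transposition.transpose i b l)) = sum H (Transposition.transpose i b ` ?T)"
      by (subst sum.reindex) (auto intro: inj_on_subset[OF inj_transpose])
    also have "\<dots> \<le> sum H S"
      by (rule sum_mono2) (use fin b ij H in \<open>auto simp: Transposition.transpose_def\<close>)
    finally show "(\<Sum>q | q permutes ?T. H (Transposition.transpose i b (q j))) \<le> fact (card S - 2) * sum H S"
      using fin ij by (simp add: numeral_2_eq_2)
    show "0 \<le> F b" using b F S by auto
  qed
  also have "\<dots> = fact (card S - 2) * (sum F S * sum H S)"
    unfolding S[symmetric] sum_distrib_right[symmetric] by (simp add: mult_ac)
  finally show ?thesis unfolding S[symmetric] .
qed

section \<open>Lower and upper bounds for the permutation average with arbitrary
  coefficients\<close>

definition perm_avg :: "nat \<Rightarrow> (nat \<Rightarrow> real) \<Rightarrow> (nat \<Rightarrow> real) \<Rightarrow> real" where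
  "perm_avg n c x = (1 / fact n) *
     (\<Sum>\<pi> | \<pi> permutes {1..n}. sqrt (\<Sum>i=1..n. \<bar>x i * c (\<pi> i)\<bar>\<^sup>2))"

lemma mean_permutations_eval:
  fixes F :: "nat \<Rightarrow> real"
  assumes "i \<in> {1..n}"
  shows "(\<Sum>\<pi> | \<pi> permutes {1..n}. F (\<pi> i)) = fact n * ((1 / real n) * (\<Sum>l=1..n. F l))"
proof -
  have "n \<ge> 1" using assms by auto
  then have "(fact n :: real) = real n * fact (n - 1)" by (simp add: fact_reduce)
  then show ?thesis using sum_permutations_eval[of "{1..n}" i F] assms by auto
qed

text \<open>The exact normalisation is \<open>1 / (n (n - 1))\<close>; two different indices force
  \<open>n \<ge> 2\<close>, where it is at most \<open>2 / n\<^sup>2\<close>.\<close>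

lemma mean_permutations_eval2_le:
  fixes F H :: "nat \<Rightarrow> real"
  assumes ij: "i \<in> {1..n}" "j \<in> {1..n}" "i \<noteq> j"
    and F: "\<And>l. l \<in> {1..n} \<Longrightarrow> 0 \<le> F l" and H: "\<And>l. l \<in> {1..n} \<Longrightarrow> 0 \<le> H l"
  shows "(\<Sum>\<pi> | \<pi> permutes {1..n}. F (\<pi> i) * H (\<pi> j))
    \<le> fact n * (2 * ((1 / real n) * (\<Sum>l=1..n. F l)) * ((1 / real n) * (\<Sum>l=1..n. H l)))"
proof -
  have n: "n \<ge> 2" using ij by auto
  have f: "(fact n :: real) = real n * ((real n - 1) * fact (n - 2))"
  proof -
    obtain k where k: "n = Suc (Suc k)" using n by (metis add_2_eq_Suc le_Suc_ex)
    show ?thesis unfolding k by (simp add: algebra_simps)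
  qed
  have "fact (n - 2) * real n * real n \<le> 2 * fact n"
  proof -
    have "real n \<le> 2 * (real n - 1)" using n by auto
    then have "(fact (n - 2) * real n) * real n \<le> (fact (n - 2) * real n) * (2 * (real n - 1))"
      by (intro mult_left_mono) auto
    then show ?thesis unfolding f by (simp add: algebra_simps)
  qed
  then have fn: "fact (n - 2) \<le> 2 * fact n / (real n * real n)"
    using n by (simp add: field_simps)
  have "(\<Sum>\<pi> | \<pi> permutes {1..n}. F (\<pi> i) * H (\<pi> j))
     \<le> fact (n - 2) * (sum F {1..n} * sum H {1..n})"
    using sum_permutations_eval2_le[of "{1..n}" i j F H] ij F H by simp
  also have "\<dots> \<le> 2 * fact n / (real n * real n) * (sum F {1..n} * sum H {1..n})"
    by (intro mult_right_mono fn mult_nonneg_nonneg sum_nonneg F H) auto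
  finally show ?thesis by (simp add: field_simps)
qed

text \<open>The vector with entries \<open>g i (\<pi> i)\<close>, normalised in \<open>\<ell>\<^sub>2\<close>, serves as a test functional
  for the Euclidean norm under the average. The normalising factor is linearised by a tangent
  to \<open>G \<mapsto> 1 / sqrt G\<close>, so that only pair correlations of \<open>\<pi>\<close> enter.\<close>

lemma perm_avg_ge:
  fixes x c :: "nat \<Rightarrow> real" and g :: "nat \<Rightarrow> nat \<Rightarrow> real"
  assumes x: "\<And>i. i \<in> {1..n} \<Longrightarrow> 0 \<le> x i" and c: "\<And>l. l \<in> {1..n} \<Longrightarrow> 0 \<le> c l"
    and g0: "\<And>i l. i \<in> {1..n} \<Longrightarrow> l \<in> {1..n} \<Longrightarrow> 0 \<le> g i l"
    and g1: "\<And>i l. i \<in> {1..n} \<Longrightarrow> l \<in> {1..n} \<Longrightarrow> g i l \<le> 1"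
    and gs: "(\<Sum>i=1..n. (1 / real n) * (\<Sum>l=1..n. (g i l)\<^sup>2)) \<le> 2"
  shows "(\<Sum>i=1..n. x i * ((1 / real n) * (\<Sum>l=1..n. g i l * c l))) \<le> 3 * perm_avg n c x"
proof -
  let ?P = "{\<pi>. \<pi> permutes {1..n}}"
  define m where "m F = (1 / real n) * (\<Sum>l=1..n. F l)" for F :: "nat \<Rightarrow> real"
  define z where "z i l = g i l * c l" for i l
  define Z where "Z \<pi> = (\<Sum>i=1..n. x i * z i (\<pi> i))" for \<pi>
  define G where "G \<pi> = (\<Sum>i=1..n. (g i (\<pi> i))\<^sup>2)" for \<pi>
  define X where "X \<pi> = sqrt (\<Sum>i=1..n. \<bar>x i * c (\<pi> i)\<bar>\<^sup>2)" for \<pi>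
  define E where "E = (\<Sum>i=1..n. x i * m (z i))"
  have pin: "\<pi> i \<in> {1..n}" if "\<pi> \<in> ?P" "i \<in> {1..n}" for \<pi> i
    using that permutes_in_image[of \<pi> "{1..n}" i] by simp
  have z0: "0 \<le> z i l" if "i \<in> {1..n}" "l \<in> {1..n}" for i l
    using g0[OF that] c[OF that(2)] by (simp add: z_def)
  \<comment> \<open>Cauchy-Schwarz gives \<open>Z \<le> X sqrt G\<close>. The factor
    \<open>1/2 - G/54\<close> is the tangent at \<open>G = 9\<close> of the convex function
    \<open>1 / sqrt G\<close>, with value 1/3 and slope -1/54 there.\<close>
  have key: "Z \<pi> * (1/2 - G \<pi> / 54) \<le> X \<pi>" if "\<pi> \<in> ?P" for \<pi>
  proof -
    define q where "q = sqrt (G \<pi>)"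
    have G0: "0 \<le> G \<pi>" unfolding G_def by (simp add: sum_nonneg)
    have q: "0 \<le> q" "q\<^sup>2 = G \<pi>" using G0 by (auto simp: q_def)
    have X0: "0 \<le> X \<pi>" unfolding X_def by (simp add: sum_nonneg)
    have Z0: "0 \<le> Z \<pi>" unfolding Z_def
      by (intro sum_nonneg mult_nonneg_nonneg x z0 pin[OF that])
    have "Z \<pi> = (\<Sum>i=1..n. (x i * c (\<pi> i)) * g i (\<pi> i))"
      by (simp add: Z_def z_def mult_ac)
    also have "\<dots> \<le> (\<Sum>i=1..n. \<bar>x i * c (\<pi> i)\<bar> * \<bar>g i (\<pi> i)\<bar>)"
      by (intro sum_mono) (metis abs_mult abs_ge_self)
    also have "\<dots> \<le> X \<pi> * q"
      using L2_set_mult_ineq[of "\<lambda>i. x i * c (\<pi> i)" "\<lambda>i. g i (\<pi> i)" "{1..n}"]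
      by (simp add: L2_set_def X_def q_def G_def)
    finally have ZX: "Z \<pi> \<le> X \<pi> * q" .
    show ?thesis
    proof (cases "1/2 - G \<pi> / 54 \<le> 0")
      case True
      then show ?thesis using Z0 X0 by (meson mult_nonneg_nonpos order_trans)
    next
      case False
      have "0 \<le> (q - 3)\<^sup>2 * (q + 6)" using q by simp
      then have "q * (1/2 - q\<^sup>2 / 54) \<le> 1"
        by (simp add: power2_eq_square algebra_simps)
      then have "q * (1/2 - G \<pi> / 54) \<le> 1" using q by simp
      then have "X \<pi> * (q * (1/2 - G \<pi> / 54)) \<le> X \<pi> * 1" using X0 by (rule mult_left_mono)
      moreover have "Z \<pi> * (1/2 - G \<pi> / 54) \<le> X \<pi> * q * (1/2 - G \<pi> / 54)"
        using ZX False by (intro mult_right_mono) auto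
      ultimately show ?thesis by (simp add: mult_ac)
    qed
  qed
  have EZ: "(\<Sum>\<pi>\<in>?P. Z \<pi>) = fact n * E"
  proof -
    have "(\<Sum>\<pi>\<in>?P. Z \<pi>) = (\<Sum>i=1..n. x i * (\<Sum>\<pi>\<in>?P. z i (\<pi> i)))"
      unfolding Z_def by (subst sum.swap) (simp add: sum_distrib_left)
    also have "\<dots> = (\<Sum>i=1..n. x i * (fact n * m (z i)))"
      by (intro sum.cong refl) (simp only: mean_permutations_eval m_def)
    finally show ?thesis by (simp add: E_def sum_distrib_left mult_ac)
  qed
  \<comment> \<open>The diagonal term contributes at most one mean of \<open>z i\<close>, because
    \<open>g \<le> 1\<close>. The other terms contribute at most twice that mean times the total
    mean 2 of the squares, which makes 1 + 4 = 5.\<close>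
  have pair: "(\<Sum>\<pi>\<in>?P. z i (\<pi> i) * G \<pi>) \<le> fact n * (5 * m (z i))" if i: "i \<in> {1..n}" for i
  proof -
    have mz: "0 \<le> m (z i)" unfolding m_def by (intro mult_nonneg_nonneg sum_nonneg z0[OF i]) auto
    have "(\<Sum>\<pi>\<in>?P. z i (\<pi> i) * (g j (\<pi> j))\<^sup>2)
       \<le> fact n * m (z i) * ((if j = i then 1 else 0) + 2 * m (\<lambda>l. (g j l)\<^sup>2))"
      if j: "j \<in> {1..n}" for j
    proof -
      have mg: "0 \<le> m (\<lambda>l. (g j l)\<^sup>2)" unfolding m_def by (simp add: sum_nonneg)
      show ?thesis
      proof (cases "j = i")
        case True
        have "(\<Sum>\<pi>\<in>?P. z i (\<pi> i) * (g j (\<pi> j))\<^sup>2) \<le> (\<Sum>\<pi>\<in>?P. z i (\<pi> i))"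
        proof (rule sum_mono)
          fix \<pi> assume p: "\<pi> \<in> ?P"
          have "(g j (\<pi> j))\<^sup>2 \<le> 1"
            using g0[OF j pin[OF p j]] g1[OF j pin[OF p j]] by (rule power_le_one)
          then show "z i (\<pi> i) * (g j (\<pi> j))\<^sup>2 \<le> z i (\<pi> i)"
            using z0[OF i pin[OF p i]] by (simp add: mult_left_le)
        qed
        also have "\<dots> = fact n * m (z i)" unfolding m_def using i by (rule mean_permutations_eval)
        also have "\<dots> \<le> fact n * m (z i) * (1 + 2 * m (\<lambda>l. (g j l)\<^sup>2))"
          using mz mg by (simp add: distrib_left)
        finally show ?thesis using True by simp
      next
        case False
        then show ?thesis
          using mean_permutations_eval2_le[of i n j "z i" "\<lambda>l. (g j l)\<^sup>2"] i j z0
          by (simp add: m_def mult_ac)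
      qed
    qed
    then have "(\<Sum>j=1..n. \<Sum>\<pi>\<in>?P. z i (\<pi> i) * (g j (\<pi> j))\<^sup>2)
      \<le> (\<Sum>j=1..n. fact n * m (z i) * ((if j = i then 1 else 0) + 2 * m (\<lambda>l. (g j l)\<^sup>2)))"
      by (rule sum_mono)
    also have "\<dots> = fact n * m (z i) * (1 + 2 * (\<Sum>j=1..n. m (\<lambda>l. (g j l)\<^sup>2)))"
    proof -
      have "(\<Sum>j=1..n. (if j = i then 1 else 0 :: real)) = 1"
        using i by simp
      then show ?thesis
        by (simp only: sum_distrib_left[symmetric] sum.distrib)
    qed
    also have "\<dots> \<le> fact n * m (z i) * 5"
    proof (rule mult_left_mono)
      show "1 + 2 * (\<Sum>j=1..n. m (\<lambda>l. (g j l)\<^sup>2)) \<le> 5" using gs by (simp add: m_def)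
      show "0 \<le> fact n * m (z i)" using mz by simp
    qed
    finally have *: "(\<Sum>j=1..n. \<Sum>\<pi>\<in>?P. z i (\<pi> i) * (g j (\<pi> j))\<^sup>2) \<le> fact n * m (z i) * 5" .
    have "(\<Sum>\<pi>\<in>?P. z i (\<pi> i) * G \<pi>) = (\<Sum>j=1..n. \<Sum>\<pi>\<in>?P. z i (\<pi> i) * (g j (\<pi> j))\<^sup>2)"
      unfolding G_def by (subst sum.swap) (simp add: sum_distrib_left)
    then show ?thesis using * by (simp add: mult_ac)
  qed
  have EZG: "(\<Sum>\<pi>\<in>?P. Z \<pi> * G \<pi>) \<le> fact n * (5 * E)"
  proof -
    have "(\<Sum>\<pi>\<in>?P. Z \<pi> * G \<pi>) = (\<Sum>i=1..n. x i * (\<Sum>\<pi>\<in>?P. z i (\<pi> i) * G \<pi>))"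
      unfolding Z_def sum_distrib_right
      by (subst sum.swap) (simp add: sum_distrib_left mult_ac)
    also have "\<dots> \<le> (\<Sum>i=1..n. x i * (fact n * (5 * m (z i))))"
      by (intro sum_mono mult_left_mono pair x)
    finally show ?thesis by (simp add: E_def sum_distrib_left mult_ac)
  qed
  have E0: "0 \<le> E" unfolding E_def m_def
    by (intro sum_nonneg mult_nonneg_nonneg x z0) auto
  have "(\<Sum>\<pi>\<in>?P. Z \<pi> * (1/2 - G \<pi> / 54)) \<le> (\<Sum>\<pi>\<in>?P. X \<pi>)"
    by (rule sum_mono[OF key])
  moreover have "(\<Sum>\<pi>\<in>?P. Z \<pi> * (1/2 - G \<pi> / 54))
     = (1/2) * (\<Sum>\<pi>\<in>?P. Z \<pi>) - (1/54) * (\<Sum>\<pi>\<in>?P. Z \<pi> * G \<pi>)"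
    by (simp add: right_diff_distrib sum_subtractf sum_distrib_left)
  ultimately have "fact n * E * (1/2 - 5/54) \<le> (\<Sum>\<pi>\<in>?P. X \<pi>)"
    using EZ EZG by (simp add: algebra_simps)
  moreover have "0 \<le> fact n * E" using E0 by simp
  \<comment> \<open>The factor \<open>1/2 - 5/54 = 22/54\<close> exceeds 1/3.\<close>
  moreover have "y \<le> 3 * S" if "y * (1/2 - 5/54) \<le> S" "0 \<le> y" for y S :: real
    using that by (simp add: field_simps)
  ultimately have "fact n * E \<le> 3 * (\<Sum>\<pi>\<in>?P. X \<pi>)" by blast
  then have "E \<le> 3 * ((1 / fact n) * (\<Sum>\<pi>\<in>?P. X \<pi>))"
    by (simp add: field_simps)
  then show ?thesis
    unfolding E_def m_def z_def X_def perm_avg_def .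
qed

text \<open>Row \<open>i\<close> of the matrix of entries \<open>x i * c l\<close> is cut after
  column \<open>k i\<close>. The Euclidean norm of the head is bounded by its l1 norm, whose mean is
  explicit; for the tail, Jensen's inequality moves the square root outside the average.\<close>

lemma perm_avg_le:
  fixes x c :: "nat \<Rightarrow> real" and k :: "nat \<Rightarrow> nat"
  assumes x: "\<And>i. i \<in> {1..n} \<Longrightarrow> 0 \<le> x i" and c: "\<And>l. l \<in> {1..n} \<Longrightarrow> 0 \<le> c l"
    and k: "\<And>i. i \<in> {1..n} \<Longrightarrow> k i \<le> n"
  shows "perm_avg n c x \<le> (\<Sum>i=1..n. x i * ((1 / real n) * (\<Sum>l=1..k i. c l)))
     + sqrt (\<Sum>i=1..n. (x i)\<^sup>2 * ((1 / real n) * (\<Sum>l=Suc (k i)..n. (c l)\<^sup>2)))"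
proof -
  let ?P = "{\<pi>. \<pi> permutes {1..n}}"
  define u where "u i l = (if l \<le> k i then x i * c l else 0)" for i l
  define v where "v i l = (if l \<le> k i then 0 else (x i * c l)\<^sup>2)" for i l
  define X where "X \<pi> = sqrt (\<Sum>i=1..n. \<bar>x i * c (\<pi> i)\<bar>\<^sup>2)" for \<pi>
  define U where "U \<pi> = (\<Sum>i=1..n. u i (\<pi> i))" for \<pi>
  define V where "V \<pi> = (\<Sum>i=1..n. v i (\<pi> i))" for \<pi>
  have pin: "\<pi> i \<in> {1..n}" if "\<pi> \<in> ?P" "i \<in> {1..n}" for \<pi> i
    using that permutes_in_image[of \<pi> "{1..n}" i] by simp
  have fin: "finite ?P" by (simp add: finite_permutations)
  have cardP: "real (card ?P) = fact n" by (simp add: card_permutations)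
  have V0: "0 \<le> V \<pi>" for \<pi> unfolding V_def v_def by (intro sum_nonneg) auto
  have XUV: "X \<pi> \<le> U \<pi> + sqrt (V \<pi>)" if "\<pi> \<in> ?P" for \<pi>
  proof -
    have u0: "0 \<le> u i (\<pi> i)" if "i \<in> {1..n}" for i
      using x[OF that] c[OF pin[OF \<open>\<pi> \<in> ?P\<close> that]] by (simp add: u_def)
    have "(\<Sum>i=1..n. \<bar>x i * c (\<pi> i)\<bar>\<^sup>2) = (\<Sum>i=1..n. (u i (\<pi> i))\<^sup>2) + V \<pi>"
      unfolding V_def sum.distrib[symmetric] u_def v_def by (intro sum.cong) auto
    then have "X \<pi> \<le> sqrt (\<Sum>i=1..n. (u i (\<pi> i))\<^sup>2) + sqrt (V \<pi>)"
      unfolding X_def using V0 by (simp add: sqrt_add_le_add_sqrt sum_nonneg)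
    moreover have "sqrt (\<Sum>i=1..n. (u i (\<pi> i))\<^sup>2) \<le> U \<pi>"
      using L2_set_le_sum[of "{1..n}" "\<lambda>i. u i (\<pi> i)"] u0 by (simp add: L2_set_def U_def)
    ultimately show ?thesis by simp
  qed
  have EU: "(\<Sum>\<pi>\<in>?P. U \<pi>) = fact n * (\<Sum>i=1..n. x i * ((1 / real n) * (\<Sum>l=1..k i. c l)))"
  proof -
    have "(\<Sum>\<pi>\<in>?P. U \<pi>) = (\<Sum>i=1..n. \<Sum>\<pi>\<in>?P. u i (\<pi> i))"
      unfolding U_def by (rule sum.swap)
    also have "\<dots> = (\<Sum>i=1..n. fact n * ((1 / real n) * (\<Sum>l=1..n. u i l)))"
      by (intro sum.cong refl) (simp only: mean_permutations_eval)
    also have "\<dots> = (\<Sum>i=1..n. fact n * ((1 / real n) * (x i * (\<Sum>l=1..k i. c l))))"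
    proof (intro sum.cong refl arg_cong2[where f="(*)"])
      fix i assume i: "i \<in> {1..n}"
      have "(\<Sum>l=1..n. u i l) = (\<Sum>l=1..k i. u i l)"
        by (rule sum.mono_neutral_right) (use k[OF i] in \<open>auto simp: u_def\<close>)
      then show "(\<Sum>l=1..n. u i l) = x i * (\<Sum>l=1..k i. c l)"
        by (simp add: u_def sum_distrib_left)
    qed
    finally show ?thesis by (simp add: sum_distrib_left mult_ac)
  qed
  have EV: "(\<Sum>\<pi>\<in>?P. V \<pi>)
      = fact n * (\<Sum>i=1..n. (x i)\<^sup>2 * ((1 / real n) * (\<Sum>l=Suc (k i)..n. (c l)\<^sup>2)))"
  proof -
    have "(\<Sum>\<pi>\<in>?P. V \<pi>) = (\<Sum>i=1..n. \<Sum>\<pi>\<in>?P. v i (\<pi> i))"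
      unfolding V_def by (rule sum.swap)
    also have "\<dots> = (\<Sum>i=1..n. fact n * ((1 / real n) * (\<Sum>l=1..n. v i l)))"
      by (intro sum.cong refl) (simp only: mean_permutations_eval)
    also have "\<dots> = (\<Sum>i=1..n. fact n * ((1 / real n) * ((x i)\<^sup>2 * (\<Sum>l=Suc (k i)..n. (c l)\<^sup>2))))"
    proof (intro sum.cong refl arg_cong2[where f="(*)"])
      fix i assume i: "i \<in> {1..n}"
      have "(\<Sum>l=1..n. v i l) = (\<Sum>l=Suc (k i)..n. v i l)"
        by (rule sum.mono_neutral_right) (auto simp: v_def)
      then show "(\<Sum>l=1..n. v i l) = (x i)\<^sup>2 * (\<Sum>l=Suc (k i)..n. (c l)\<^sup>2)"
        by (simp add: v_def sum_distrib_left power_mult_distrib)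
    qed
    finally show ?thesis by (simp add: sum_distrib_left mult_ac)
  qed
  \<comment> \<open>Jensen for the square root, obtained as Cauchy-Schwarz against the constant
    1.\<close>
  have "(\<Sum>\<pi>\<in>?P. sqrt (V \<pi>)) \<le> sqrt (fact n) * sqrt (\<Sum>\<pi>\<in>?P. V \<pi>)"
  proof -
    have "(\<Sum>\<pi>\<in>?P. \<bar>1\<bar> * \<bar>sqrt (V \<pi>)\<bar>) \<le> L2_set (\<lambda>_. 1) ?P * L2_set (\<lambda>\<pi>. sqrt (V \<pi>)) ?P"
      by (rule L2_set_mult_ineq)
    then show ?thesis using V0 cardP by (simp add: L2_set_def)
  qed
  also have "\<dots> = fact n * sqrt (\<Sum>i=1..n. (x i)\<^sup>2 * ((1 / real n) * (\<Sum>l=Suc (k i)..n. (c l)\<^sup>2)))"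
    unfolding EV real_sqrt_mult by simp
  finally have "(\<Sum>\<pi>\<in>?P. X \<pi>) \<le> fact n * (\<Sum>i=1..n. x i * ((1 / real n) * (\<Sum>l=1..k i. c l)))
     + fact n * sqrt (\<Sum>i=1..n. (x i)\<^sup>2 * ((1 / real n) * (\<Sum>l=Suc (k i)..n. (c l)\<^sup>2)))"
    using sum_mono[of ?P X "\<lambda>\<pi>. U \<pi> + sqrt (V \<pi>)"] XUV EU by (simp add: sum.distrib)
  then show ?thesis
    unfolding perm_avg_def X_def by (simp add: field_simps)
qed

section \<open>Decreasing functions and their cell averages\<close>

lemma sum_telescope_nat:
  fixes F :: "nat \<Rightarrow> real"
  assumes "k \<le> n"
  shows "(\<Sum>l=Suc k..n. F (l - 1) - F l) = F k - F n"
  using assms by (induction n rule: dec_induct) auto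

text \<open>The index of the cell \<open>((l - 1)/n, l/n]\<close> that contains \<open>s\<close>.
  The maximum puts \<open>s = 0\<close> into the first cell, so the right end \<open>l/n\<close> is
  always positive, as the statements about \<open>Q\<close> require.\<close>

definition cell_of :: "nat \<Rightarrow> real \<Rightarrow> nat" where
  "cell_of n s = nat (max 1 \<lceil>real n * s\<rceil>)"

lemma cell_of_bounds:
  assumes "n \<ge> 1" "0 \<le> s" "s \<le> 1"
  shows "1 \<le> cell_of n s" "cell_of n s \<le> n" "s \<le> real (cell_of n s) / real n"
    "real (cell_of n s) / real n \<le> s + 1 / real n"
proof -
  have "\<lceil>real n * s\<rceil> \<le> \<lceil>real n\<rceil>"
    using assms by (intro ceiling_mono) (simp add: mult_left_le)
  then have le: "\<lceil>real n * s\<rceil> \<le> int n" by simp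
  have r: "real (cell_of n s) = real_of_int (max 1 \<lceil>real n * s\<rceil>)"
    unfolding cell_of_def by simp
  show "1 \<le> cell_of n s" unfolding cell_of_def by simp
  show "cell_of n s \<le> n" unfolding cell_of_def using le assms by simp
  have "real n * s \<le> real (cell_of n s)" unfolding r by linarith
  then show "s \<le> real (cell_of n s) / real n" using assms by (simp add: field_simps)
  have "0 \<le> real n * s" using assms by simp
  then have "real (cell_of n s) \<le> real n * s + 1" unfolding r by linarith
  then have "real (cell_of n s) / real n \<le> (real n * s + 1) / real n"
    by (rule divide_right_mono) simp
  then show "real (cell_of n s) / real n \<le> s + 1 / real n"
    using assms by (simp add: add_divide_distrib)
qed

text \<open>Only the integral of \<open>a\<close> itself reaches down to 0: \<open>a\<close> is left
  free to blow up there, and \<open>a\<^sup>2\<close> is asked to be integrable away from 0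
  only.\<close>

locale decreasing_profile =
  fixes a P Q f :: "real \<Rightarrow> real"
  assumes a_antimono: "0 < r \<Longrightarrow> r \<le> t \<Longrightarrow> t \<le> 1 \<Longrightarrow> a t \<le> a r"
    and a_nonneg: "0 < t \<Longrightarrow> t \<le> 1 \<Longrightarrow> 0 \<le> a t"
    and a_has_integral: "0 \<le> r \<Longrightarrow> r \<le> t \<Longrightarrow> t \<le> 1 \<Longrightarrow> (a has_integral (P t - P r)) {r..t}"
    and a_sq_has_integral:
      "0 < r \<Longrightarrow> r \<le> t \<Longrightarrow> t \<le> 1 \<Longrightarrow> ((\<lambda>u. (a u)\<^sup>2) has_integral (Q r - Q t)) {r..t}"
    and P_0: "P 0 = 0" and Q_1: "Q 1 = 0" and f_0: "f 0 = 0" and f_1: "f 1 = 1"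
    and f_mono: "0 \<le> r \<Longrightarrow> r \<le> t \<Longrightarrow> t \<le> 1 \<Longrightarrow> f r \<le> f t"
    and f_eq: "0 < s \<Longrightarrow> s \<le> 1 \<Longrightarrow> f s = (P s)\<^sup>2 + s * Q s"
begin

lemma P_diff_ge:
  assumes "0 \<le> r" "r \<le> t" "t \<le> 1" "\<And>u. r < u \<Longrightarrow> u < t \<Longrightarrow> K \<le> a u"
  shows "(t - r) * K \<le> P t - P r"
proof -
  \<comment> \<open>Changing the two end values does not affect the integral, so the lower bound is
    needed on the open interval only; at 0 nothing is known about \<open>a\<close>.\<close>
  define b where "b u = (if u = r \<or> u = t then K else a u)" for u
  have 1: "(b has_integral (P t - P r)) {r..t}"
    by (rule has_integral_spike_finite[OF _ _ a_has_integral[OF assms(1-3)], where S="{r,t}"])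
      (auto simp: b_def)
  have 2: "((\<lambda>_. K) has_integral ((t - r) *\<^sub>R K)) {r..t}"
    using has_integral_const_real[of K r t] assms by simp
  have "(t - r) *\<^sub>R K \<le> P t - P r"
    by (rule has_integral_le[OF 2 1]) (use assms in \<open>auto simp: b_def\<close>)
  then show ?thesis by simp
qed

lemma P_diff_le:
  assumes "0 < r" "r \<le> t" "t \<le> 1"
  shows "P t - P r \<le> (t - r) * a r"
proof -
  have 1: "((\<lambda>_. a r) has_integral ((t - r) *\<^sub>R a r)) {r..t}"
    using has_integral_const_real[of "a r" r t] assms by simp
  have 2: "(a has_integral (P t - P r)) {r..t}"
    using assms by (intro a_has_integral) auto
  have "P t - P r \<le> (t - r) *\<^sub>R a r"
    by (rule has_integral_le[OF 2 1]) (use assms a_antimono in auto)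
  then show ?thesis by simp
qed

lemma P_diff_ge_right:
  assumes "0 \<le> r" "r < t" "t \<le> 1"
  shows "(t - r) * a t \<le> P t - P r"
  by (rule P_diff_ge) (use assms a_antimono in auto)

lemma P_mono: "0 \<le> r \<Longrightarrow> r \<le> t \<Longrightarrow> t \<le> 1 \<Longrightarrow> P r \<le> P t"
  using P_diff_ge[of r t 0] a_nonneg by simp

lemma P_nonneg: "0 \<le> t \<Longrightarrow> t \<le> 1 \<Longrightarrow> 0 \<le> P t"
  using P_mono[of 0 t] P_0 by simp

lemma P_ge: "0 < t \<Longrightarrow> t \<le> 1 \<Longrightarrow> t * a t \<le> P t"
  using P_diff_ge_right[of 0 t] P_0 by simp

text \<open>This is concavity of \<open>P\<close> together with \<open>P 0 = 0\<close>: the mean of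
  \<open>a\<close> to the right of \<open>\<theta> * t\<close> is at most
  \<open>a (\<theta> * t)\<close>, the mean to the left at least that value.\<close>

lemma P_scale:
  assumes "0 \<le> \<theta>" "\<theta> \<le> 1" "0 \<le> t" "t \<le> 1"
  shows "\<theta> * P t \<le> P (\<theta> * t)"
proof (cases "\<theta> = 0 \<or> t = 0")
  case True
  then show ?thesis using P_0 by auto
next
  case False
  then have pos: "0 < \<theta> * t" using assms by simp
  have le: "\<theta> * t \<le> t" using assms by (simp add: mult_left_le_one_le)
  have "P t - P (\<theta> * t) \<le> (t - \<theta> * t) * a (\<theta> * t)"
    using P_diff_le[OF pos le] assms by simp
  then have "\<theta> * (P t - P (\<theta> * t)) \<le> \<theta> * ((t - \<theta> * t) * a (\<theta> * t))"
    using assms by (intro mult_left_mono)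
  also have "\<dots> = (1 - \<theta>) * ((\<theta> * t) * a (\<theta> * t))" by (simp add: algebra_simps)
  also have "\<dots> \<le> (1 - \<theta>) * P (\<theta> * t)"
    using assms P_ge[OF pos] le by (intro mult_left_mono) auto
  finally show ?thesis by (simp add: algebra_simps)
qed

lemma Q_antimono: "0 < r \<Longrightarrow> r \<le> t \<Longrightarrow> t \<le> 1 \<Longrightarrow> Q t \<le> Q r"
  using has_integral_nonneg[OF a_sq_has_integral[of r t]] by simp

lemma Q_nonneg: "0 < t \<Longrightarrow> t \<le> 1 \<Longrightarrow> 0 \<le> Q t"
  using Q_antimono[of t 1] Q_1 by simp

lemma P_le_sqrt_f:
  assumes "0 \<le> s" "s \<le> 1"
  shows "P s \<le> sqrt (f s)"
proof (cases "s = 0")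
  case True
  then show ?thesis using P_0 f_0 by simp
next
  case False
  then show ?thesis
    using assms f_eq[of s] Q_nonneg[of s] by (intro real_le_rsqrt) auto
qed

text \<open>The average of \<open>a\<close> over the \<open>l\<close>-th cell, expressed by the
  primitive \<open>P\<close>; the coefficients of the theorem are of this form.\<close>

definition cell_mean :: "nat \<Rightarrow> nat \<Rightarrow> real" where
  "cell_mean n l = real n * (P (real l / real n) - P ((real l - 1) / real n))"

lemma cell_mean_ge:
  assumes "1 \<le> l" "l \<le> n"
  shows "a (real l / real n) \<le> cell_mean n l"
proof -
  have "(real l / real n - (real l - 1) / real n) * a (real l / real n)
      \<le> P (real l / real n) - P ((real l - 1) / real n)"
    by (rule P_diff_ge_right) (use assms in \<open>auto simp: field_simps\<close>)
  moreover have "real l / real n - (real l - 1) / real n = 1 / real n"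
    by (simp add: diff_divide_distrib)
  ultimately show ?thesis unfolding cell_mean_def using assms by (simp add: field_simps)
qed

text \<open>The first cell is left out because its left end is 0, where \<open>a\<close> is not
  controlled.\<close>

lemma cell_mean_le:
  assumes "2 \<le> l" "l \<le> n"
  shows "cell_mean n l \<le> a ((real l - 1) / real n)"
proof -
  have "P (real l / real n) - P ((real l - 1) / real n)
    \<le> (real l / real n - (real l - 1) / real n) * a ((real l - 1) / real n)"
    by (rule P_diff_le) (use assms in \<open>auto simp: field_simps\<close>)
  moreover have "real l / real n - (real l - 1) / real n = 1 / real n"
    by (simp add: diff_divide_distrib)
  ultimately show ?thesis unfolding cell_mean_def using assms by (simp add: field_simps)
qed

lemma cell_mean_nonneg:
  assumes "l \<in> {1..n}"
  shows "0 \<le> cell_mean n l"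
  using cell_mean_ge[of l n] a_nonneg[of "real l / real n"] assms by (auto simp: field_simps)

lemma cell_mean_antimono:
  assumes "1 \<le> k" "k < l" "l \<le> n"
  shows "cell_mean n l \<le> cell_mean n k"
proof -
  have "cell_mean n l \<le> a ((real l - 1) / real n)" using assms by (intro cell_mean_le) auto
  also have "\<dots> \<le> a (real k / real n)"
    by (rule a_antimono) (use assms in \<open>auto simp: field_simps\<close>)
  also have "\<dots> \<le> cell_mean n k" using assms by (intro cell_mean_ge) auto
  finally show ?thesis .
qed

lemma sum_cell_mean:
  assumes "k \<le> n" "n \<ge> 1"
  shows "(1 / real n) * (\<Sum>l=1..k. cell_mean n l) = P (real k / real n)"
proof -
  have "(\<Sum>l=Suc 0..k. - P (real (l - 1) / real n) - - P (real l / real n))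
     = - P (real 0 / real n) - - P (real k / real n)"
    by (rule sum_telescope_nat) simp
  moreover have "(\<Sum>l=1..k. cell_mean n l)
     = real n * (\<Sum>l=Suc 0..k. - P (real (l - 1) / real n) - - P (real l / real n))"
    unfolding sum_distrib_left by (intro sum.cong) (auto simp: cell_mean_def of_nat_diff)
  ultimately show ?thesis using P_0 assms by simp
qed

text \<open>On each cell \<open>a\<close> is bounded by its value at the left end, hence by the mean
  over the preceding cell. This shift by one produces the extra term with index
  \<open>k\<close>.\<close>

lemma Q_le_sum:
  assumes "1 \<le> k" "k \<le> n"
  shows "Q (real k / real n) \<le>
    (1 / real n) * ((cell_mean n k)\<^sup>2 + (\<Sum>l=Suc k..n. (cell_mean n l)\<^sup>2))"
proof -
  have "Q (real k / real n) - Q (real n / real n)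
     = (\<Sum>l=Suc k..n. Q (real (l - 1) / real n) - Q (real l / real n))"
    by (rule sum_telescope_nat[symmetric]) (use assms in simp)
  also have "\<dots> \<le> (\<Sum>l=Suc k..n. (1 / real n) * (cell_mean n (l - 1))\<^sup>2)"
  proof (rule sum_mono)
    fix l assume l: "l \<in> {Suc k..n}"
    define r t where "r = real (l - 1) / real n" and "t = real l / real n"
    have rt: "0 < r" "r \<le> t" "t \<le> 1" using l assms by (auto simp: r_def t_def field_simps)
    have "((\<lambda>_. (a r)\<^sup>2) has_integral ((t - r) *\<^sub>R (a r)\<^sup>2)) {r..t}"
      using has_integral_const_real[of "(a r)\<^sup>2" r t] rt by simp
    then have "Q r - Q t \<le> (t - r) *\<^sub>R (a r)\<^sup>2"
    proof (rule has_integral_le[OF a_sq_has_integral[OF rt]])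
      fix u assume u: "u \<in> {r..t}"
      show "(a u)\<^sup>2 \<le> (a r)\<^sup>2"
        using u rt by (intro power_mono a_antimono a_nonneg) auto
    qed
    moreover have "t - r = 1 / real n" using l by (simp add: r_def t_def of_nat_diff field_simps)
    ultimately have "Q r - Q t \<le> (1 / real n) * (a r)\<^sup>2" by simp
    also have "\<dots> \<le> (1 / real n) * (cell_mean n (l - 1))\<^sup>2"
      using l assms rt cell_mean_ge[of "l - 1" n] unfolding r_def
      by (intro mult_left_mono power_mono a_nonneg) auto
    finally show "Q (real (l - 1) / real n) - Q (real l / real n) \<le> (1 / real n) * (cell_mean n (l - 1))\<^sup>2"
      unfolding r_def t_def .
  qed
  also have "\<dots> = (1 / real n) * (\<Sum>l\<in>{k..<n}. (cell_mean n l)\<^sup>2)"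
  proof -
    have "(\<Sum>l=Suc k..n. (cell_mean n (l - 1))\<^sup>2) = (\<Sum>l\<in>{k..<n}. (cell_mean n l)\<^sup>2)"
      by (rule sum.reindex_bij_witness[of _ Suc "\<lambda>l. l - 1"]) auto
    then show ?thesis by (simp add: sum_divide_distrib[symmetric])
  qed
  also have "\<dots> \<le> (1 / real n) * (\<Sum>l=k..n. (cell_mean n l)\<^sup>2)"
    by (intro mult_left_mono sum_mono2) auto
  also have "(\<Sum>l=k..n. (cell_mean n l)\<^sup>2)
     = (cell_mean n k)\<^sup>2 + (\<Sum>l=Suc k..n. (cell_mean n l)\<^sup>2)"
    using assms by (simp add: sum.atLeast_Suc_atMost)
  finally show ?thesis using Q_1 assms by simp
qed

text \<open>Jensen on each cell: the integral of \<open>(a - c)\<^sup>2\<close> is nonnegative when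
  \<open>c\<close> is the mean of \<open>a\<close>.\<close>

lemma sum_le_Q:
  assumes "1 \<le> k" "k \<le> n"
  shows "(1 / real n) * (\<Sum>l=Suc k..n. (cell_mean n l)\<^sup>2) \<le> Q (real k / real n)"
proof -
  have "(\<Sum>l=Suc k..n. (1 / real n) * (cell_mean n l)\<^sup>2)
    \<le> (\<Sum>l=Suc k..n. Q (real (l - 1) / real n) - Q (real l / real n))"
  proof (rule sum_mono)
    fix l assume l: "l \<in> {Suc k..n}"
    define r t where "r = real (l - 1) / real n" and "t = real l / real n"
    define c where "c = cell_mean n l"
    have rt: "0 < r" "r \<le> t" "t \<le> 1" using l assms by (auto simp: r_def t_def field_simps)
    have d: "t - r = 1 / real n" using l by (simp add: r_def t_def of_nat_diff field_simps)
    have c: "P t - P r = c / real n"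
      using l by (simp add: c_def cell_mean_def r_def t_def of_nat_diff)
    have "((\<lambda>_. c\<^sup>2) has_integral ((t - r) *\<^sub>R c\<^sup>2)) {r..t}"
      using has_integral_const_real[of "c\<^sup>2" r t] rt by simp
    then have "((\<lambda>u. (a u)\<^sup>2 - 2 * c * a u + c\<^sup>2) has_integral
        (Q r - Q t) - 2 * c * (P t - P r) + (t - r) *\<^sub>R c\<^sup>2) {r..t}"
      using rt by (intro has_integral_add has_integral_diff has_integral_mult_right
          a_sq_has_integral a_has_integral) auto
    then have "0 \<le> (Q r - Q t) - 2 * c * (P t - P r) + (t - r) *\<^sub>R c\<^sup>2"
    proof (rule has_integral_nonneg)
      fix u
      have "(a u)\<^sup>2 - 2 * c * a u + c\<^sup>2 = (a u - c)\<^sup>2" by (simp add: power2_eq_square algebra_simps)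
      then show "0 \<le> (a u)\<^sup>2 - 2 * c * a u + c\<^sup>2" by simp
    qed
    then have "(1 / real n) * c\<^sup>2 \<le> Q r - Q t"
      unfolding c d by (simp add: power2_eq_square)
    then show "(1 / real n) * (cell_mean n l)\<^sup>2 \<le> Q (real (l - 1) / real n) - Q (real l / real n)"
      unfolding c_def r_def t_def .
  qed
  also have "\<dots> = Q (real k / real n) - Q (real n / real n)"
    by (rule sum_telescope_nat) (use assms in simp)
  finally show ?thesis using Q_1 assms by (simp add: sum_divide_distrib)
qed

section \<open>Comparison of the pairing with the permutation average\<close>

text \<open>Up to a constant, \<open>sqrt f\<close> is the larger of \<open>A\<close>, the head
  part, and \<open>W\<close>, the tail part. If \<open>A\<close> dominates, the weights are the
  indicator of the first \<open>k\<close> cells; if \<open>W\<close> dominates, they are the tail of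
  the means, rescaled to mean square \<open>k/n\<close>.\<close>

lemma test_weights:
  assumes k: "1 \<le> k" "k \<le> n"
  obtains g where "\<And>l. l \<in> {1..n} \<Longrightarrow> 0 \<le> g l" "\<And>l. l \<in> {1..n} \<Longrightarrow> g l \<le> 1"
    "(1 / real n) * (\<Sum>l=1..n. (g l)\<^sup>2) \<le> real k / real n"
    "sqrt (f (real k / real n)) \<le> 2 * ((1 / real n) * (\<Sum>l=1..n. g l * cell_mean n l))"
proof -
  define A where "A = P (real k / real n)"
  define T where "T = (\<Sum>l=Suc k..n. (cell_mean n l)\<^sup>2)"
  define W where "W = sqrt (real k * T / (real n)\<^sup>2)"
  have n: "0 < real n" and kp: "0 < real k" using k by auto
  have kn: "0 < real k / real n" "real k / real n \<le> 1" using k by auto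
  have A0: "0 \<le> A" unfolding A_def using kn by (intro P_nonneg) auto
  have T0: "0 \<le> T" unfolding T_def by (simp add: sum_nonneg)
  have W2: "W\<^sup>2 = real k * T / (real n)\<^sup>2" unfolding W_def using T0 by simp
  have W0: "0 \<le> W" unfolding W_def using T0 by simp
  have Asum: "(1 / real n) * (\<Sum>l=1..k. cell_mean n l) = A"
    unfolding A_def using k by (intro sum_cell_mean) auto
  \<comment> \<open>The means decrease, so the \<open>k\<close>-th is at most the average of the
    first \<open>k\<close>. This absorbs the extra term of \<open>Q_le_sum\<close> into
    \<open>A\<^sup>2\<close>.\<close>
  have ck: "real k * cell_mean n k \<le> real n * A"
  proof -
    have "real k * cell_mean n k = (\<Sum>l=1..k. cell_mean n k)" by simp
    also have "\<dots> \<le> (\<Sum>l=1..k. cell_mean n l)"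
    proof (rule sum_mono)
      fix l assume "l \<in> {1..k}"
      then show "cell_mean n k \<le> cell_mean n l"
        using cell_mean_antimono[of l k n] k by (cases "l = k") auto
    qed
    also have "\<dots> = real n * A" using Asum n by (simp add: field_simps)
    finally show ?thesis .
  qed
  have c0: "0 \<le> cell_mean n l" if "l \<in> {1..n}" for l using cell_mean_nonneg that by blast
  have "f (real k / real n) = A\<^sup>2 + real k / real n * Q (real k / real n)"
    unfolding A_def using kn by (rule f_eq)
  also have "\<dots> \<le> A\<^sup>2 + real k / real n * ((1 / real n) * ((cell_mean n k)\<^sup>2 + T))"
    unfolding T_def using k by (intro add_left_mono mult_left_mono Q_le_sum) auto
  also have "\<dots> = A\<^sup>2 + (real k * (cell_mean n k)\<^sup>2 / (real n)\<^sup>2 + W\<^sup>2)"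
    unfolding W2 by (simp add: power2_eq_square algebra_simps add_divide_distrib)
  also have "real k * (cell_mean n k)\<^sup>2 / (real n)\<^sup>2 \<le> A\<^sup>2"
  proof -
    have "real k * (cell_mean n k)\<^sup>2 \<le> (real k)\<^sup>2 * (cell_mean n k)\<^sup>2"
      using k by (intro mult_right_mono) (auto simp: power2_eq_square)
    also have "\<dots> = (real k * cell_mean n k)\<^sup>2" by (simp add: power_mult_distrib)
    also have "\<dots> \<le> (real n * A)\<^sup>2"
      using ck c0[of k] k by (intro power_mono) auto
    finally show ?thesis using n by (simp add: power_mult_distrib field_simps)
  qed
  finally have f_le: "f (real k / real n) \<le> 2 * A\<^sup>2 + W\<^sup>2" by simp
  show thesis
  proof (cases "W \<le> A")
    case True
    define g where "g l = (if l \<le> k then 1 else 0 :: real)" for l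
    show thesis
    proof (rule that)
      show "0 \<le> g l" "g l \<le> 1" for l by (auto simp: g_def)
      have "(\<Sum>l=1..n. (g l)\<^sup>2) = (\<Sum>l=1..k. (g l)\<^sup>2)"
        by (rule sum.mono_neutral_right) (use k in \<open>auto simp: g_def\<close>)
      then show "(1 / real n) * (\<Sum>l=1..n. (g l)\<^sup>2) \<le> real k / real n" by (simp add: g_def)
      have "(\<Sum>l=1..n. g l * cell_mean n l) = (\<Sum>l=1..k. g l * cell_mean n l)"
        by (rule sum.mono_neutral_right) (use k in \<open>auto simp: g_def\<close>)
      then have *: "(1 / real n) * (\<Sum>l=1..n. g l * cell_mean n l) = A"
        using Asum by (simp add: g_def)
      \<comment> \<open>Here \<open>2 * A\<^sup>2 + W\<^sup>2\<close> is at most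
        \<open>3 * A\<^sup>2\<close>, hence at most \<open>(2 * A)\<^sup>2\<close>.\<close>
      have "W\<^sup>2 \<le> A\<^sup>2" using True W0 by (intro power_mono)
      then have "f (real k / real n) \<le> (2 * A)\<^sup>2"
        using f_le unfolding power_mult_distrib by (simp add: zero_le_power2) (smt (verit) zero_le_power2)
      then show "sqrt (f (real k / real n)) \<le> 2 * ((1 / real n) * (\<Sum>l=1..n. g l * cell_mean n l))"
        unfolding * using A0 by (intro real_le_lsqrt) auto
    qed
  next
    case False
    then have Wp: "0 < W" using A0 by simp
    \<comment> \<open>Chosen so that \<open>T / B\<^sup>2 = k\<close>. That the tail weights stay
      below 1 is where the dominance of \<open>W\<close> enters: beyond \<open>k\<close> the means
      are at most \<open>n * A / k\<close>, and \<open>A < W\<close>.\<close>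
    define B where "B = W * real n / real k"
    have Bp: "0 < B" unfolding B_def using Wp n kp by simp
    have TB: "T = B * (real n * W)" "T / B\<^sup>2 = real k"
    proof -
      have T: "T = W\<^sup>2 * (real n)\<^sup>2 / real k" unfolding W2 using n kp by simp
      show "T = B * (real n * W)" unfolding T B_def by (simp add: power2_eq_square)
      show "T / B\<^sup>2 = real k" unfolding T B_def using Wp n kp by (simp add: power2_eq_square)
    qed
    define g where "g l = (if l \<le> k then 0 else cell_mean n l / B)" for l
    show thesis
    proof (rule that)
      show "0 \<le> g l" if "l \<in> {1..n}" for l using c0[OF that] Bp by (auto simp: g_def)
      show "g l \<le> 1" if "l \<in> {1..n}" for l
      proof (cases "l \<le> k")
        case False
        then have "real k * cell_mean n l \<le> real k * cell_mean n k"
          using that k by (intro mult_left_mono cell_mean_antimono) auto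
        also have "\<dots> \<le> real n * W" using ck \<open>\<not> W \<le> A\<close> n by (smt (verit) mult_left_mono)
        finally have "cell_mean n l \<le> B" unfolding B_def using kp by (simp add: field_simps)
        then show ?thesis using Bp by (simp add: g_def)
      qed (simp add: g_def)
      have "(\<Sum>l=1..n. (g l)\<^sup>2) = (\<Sum>l=Suc k..n. (g l)\<^sup>2)"
        by (rule sum.mono_neutral_right) (use k in \<open>auto simp: g_def\<close>)
      also have "\<dots> = T / B\<^sup>2"
        unfolding T_def sum_divide_distrib by (intro sum.cong) (auto simp: g_def power_divide)
      finally show "(1 / real n) * (\<Sum>l=1..n. (g l)\<^sup>2) \<le> real k / real n"
        using TB by simp
      have "(\<Sum>l=1..n. g l * cell_mean n l) = (\<Sum>l=Suc k..n. g l * cell_mean n l)"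
        by (rule sum.mono_neutral_right) (use k in \<open>auto simp: g_def\<close>)
      also have "\<dots> = T / B"
        unfolding T_def sum_divide_distrib
        by (intro sum.cong) (auto simp: g_def power2_eq_square)
      finally have *: "(1 / real n) * (\<Sum>l=1..n. g l * cell_mean n l) = W"
        unfolding TB(1) using Bp n by simp
      have "A\<^sup>2 \<le> W\<^sup>2" using False A0 by (intro power_mono) auto
      then have "f (real k / real n) \<le> (2 * W)\<^sup>2"
        using f_le unfolding power_mult_distrib by simp (smt (verit) zero_le_power2)
      then show "sqrt (f (real k / real n)) \<le> 2 * ((1 / real n) * (\<Sum>l=1..n. g l * cell_mean n l))"
        unfolding * using W0 by (intro real_le_lsqrt) auto
    qed
  qed
qed

text \<open>Rounding each \<open>s i\<close> up to the grid adds at most \<open>1/n\<close>, so the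
  mean squares of the weights sum to at most 2, the amount that \<open>perm_avg_ge\<close> admits.
  The factor 6 is 2 from \<open>test_weights\<close> times 3 from
  \<open>perm_avg_ge\<close>.\<close>

theorem sum_le_perm_avg:
  assumes n: "n \<ge> 1" and x: "\<And>i. i \<in> {1..n} \<Longrightarrow> 0 \<le> x i"
    and s: "\<And>i. i \<in> {1..n} \<Longrightarrow> 0 \<le> s i" "(\<Sum>i=1..n. s i) \<le> 1"
  shows "(\<Sum>i=1..n. x i * sqrt (f (s i))) \<le> 6 * perm_avg n (cell_mean n) x"
proof -
  have s1: "s i \<le> 1" if "i \<in> {1..n}" for i
    using member_le_sum[of i "{1..n}" s] that s by simp
  define k where "k i = cell_of n (s i)" for i
  have k: "1 \<le> k i" "k i \<le> n" "s i \<le> real (k i) / real n" "real (k i) / real n \<le> s i + 1 / real n"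
    if "i \<in> {1..n}" for i
    unfolding k_def using cell_of_bounds[of n "s i"] n s(1) s1 that by auto
  have "\<forall>i\<in>{1..n}. \<exists>g. (\<forall>l\<in>{1..n}. 0 \<le> g l) \<and> (\<forall>l\<in>{1..n}. g l \<le> 1) \<and>
    (1 / real n) * (\<Sum>l=1..n. (g l)\<^sup>2) \<le> real (k i) / real n \<and>
    sqrt (f (real (k i) / real n)) \<le> 2 * ((1 / real n) * (\<Sum>l=1..n. g l * cell_mean n l))"
  proof
    fix i assume i: "i \<in> {1..n}"
    obtain g where "\<And>l. l \<in> {1..n} \<Longrightarrow> 0 \<le> g l" "\<And>l. l \<in> {1..n} \<Longrightarrow> g l \<le> 1"
      "(1 / real n) * (\<Sum>l=1..n. (g l)\<^sup>2) \<le> real (k i) / real n"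
      "sqrt (f (real (k i) / real n)) \<le> 2 * ((1 / real n) * (\<Sum>l=1..n. g l * cell_mean n l))"
      using test_weights[OF k(1)[OF i] k(2)[OF i]] by blast
    then show "\<exists>g. (\<forall>l\<in>{1..n}. 0 \<le> g l) \<and> (\<forall>l\<in>{1..n}. g l \<le> 1) \<and>
      (1 / real n) * (\<Sum>l=1..n. (g l)\<^sup>2) \<le> real (k i) / real n \<and>
      sqrt (f (real (k i) / real n)) \<le> 2 * ((1 / real n) * (\<Sum>l=1..n. g l * cell_mean n l))"
      by blast
  qed
  from bchoice[OF this] obtain g where G: "\<forall>i\<in>{1..n}. (\<forall>l\<in>{1..n}. 0 \<le> g i l) \<and>
    (\<forall>l\<in>{1..n}. g i l \<le> 1) \<and>
    (1 / real n) * (\<Sum>l=1..n. (g i l)\<^sup>2) \<le> real (k i) / real n \<and>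
    sqrt (f (real (k i) / real n)) \<le> 2 * ((1 / real n) * (\<Sum>l=1..n. g i l * cell_mean n l))"
    by blast
  then have g: "\<And>i l. i \<in> {1..n} \<Longrightarrow> l \<in> {1..n} \<Longrightarrow> 0 \<le> g i l"
    "\<And>i l. i \<in> {1..n} \<Longrightarrow> l \<in> {1..n} \<Longrightarrow> g i l \<le> 1"
    "\<And>i. i \<in> {1..n} \<Longrightarrow> (1 / real n) * (\<Sum>l=1..n. (g i l)\<^sup>2) \<le> real (k i) / real n"
    "\<And>i. i \<in> {1..n} \<Longrightarrow> sqrt (f (real (k i) / real n))
        \<le> 2 * ((1 / real n) * (\<Sum>l=1..n. g i l * cell_mean n l))"
    by blast+
  have "(\<Sum>i=1..n. (1 / real n) * (\<Sum>l=1..n. (g i l)\<^sup>2)) \<le> (\<Sum>i=1..n. s i + 1 / real n)"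
    by (intro sum_mono) (use g(3) k(4) in \<open>fastforce intro: order_trans\<close>)
  also have "\<dots> \<le> 2" using s(2) n by (simp add: sum.distrib)
  finally have gs: "(\<Sum>i=1..n. (1 / real n) * (\<Sum>l=1..n. (g i l)\<^sup>2)) \<le> 2" .
  have "(\<Sum>i=1..n. x i * sqrt (f (s i)))
     \<le> (\<Sum>i=1..n. 2 * (x i * ((1 / real n) * (\<Sum>l=1..n. g i l * cell_mean n l))))"
  proof (rule sum_mono)
    fix i assume i: "i \<in> {1..n}"
    have "f (s i) \<le> f (real (k i) / real n)"
      using s(1)[OF i] k[OF i] n by (intro f_mono) auto
    then have "sqrt (f (s i)) \<le> 2 * ((1 / real n) * (\<Sum>l=1..n. g i l * cell_mean n l))"
      using g(4)[OF i] by (meson order_trans real_sqrt_le_mono)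
    then have "x i * sqrt (f (s i)) \<le> x i * (2 * ((1 / real n) * (\<Sum>l=1..n. g i l * cell_mean n l)))"
      using x[OF i] by (rule mult_left_mono)
    then show "x i * sqrt (f (s i)) \<le> 2 * (x i * ((1 / real n) * (\<Sum>l=1..n. g i l * cell_mean n l)))"
      by (simp add: mult_ac)
  qed
  also have "\<dots> = 2 * (\<Sum>i=1..n. x i * ((1 / real n) * (\<Sum>l=1..n. g i l * cell_mean n l)))"
    by (simp only: sum_distrib_left)
  also have "\<dots> \<le> 2 * (3 * perm_avg n (cell_mean n) x)"
    by (intro mult_left_mono perm_avg_ge x g gs cell_mean_nonneg) auto
  finally show ?thesis by simp
qed

text \<open>The bound \<open>R\<close> on the dual pairing selects, for each coordinate, the level \<open>\<sigma>\<close> above which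
  \<open>x * a > 2 R\<close>; testing the bound with these levels shows that they sum to at most 1.\<close>

theorem perm_avg_le_of_bound:
  assumes n: "n \<ge> 1" and x: "\<And>i. i \<in> {1..n} \<Longrightarrow> 0 \<le> x i"
    and R: "\<And>s. (\<And>i. i \<in> {1..n} \<Longrightarrow> 0 \<le> s i) \<Longrightarrow> (\<Sum>i=1..n. s i) \<le> 1 \<Longrightarrow>
        (\<Sum>i=1..n. x i * sqrt (f (s i))) \<le> R"
  shows "perm_avg n (cell_mean n) x \<le> 4 * R"
proof -
  let ?I = "{1..n}"
  have R0: "0 \<le> R" using R[of "\<lambda>_. 0"] f_0 by simp
  have le1: "s i \<le> 1" if "\<And>i. i \<in> ?I \<Longrightarrow> 0 \<le> s i" "(\<Sum>i=1..n. s i) \<le> 1" "i \<in> ?I" for s :: "nat \<Rightarrow> real" and i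
    using member_le_sum[of i ?I s] that by simp
  have RP: "(\<Sum>i=1..n. x i * P (s i)) \<le> R"
    if "\<And>i. i \<in> ?I \<Longrightarrow> 0 \<le> s i" "(\<Sum>i=1..n. s i) \<le> 1" for s
  proof -
    have "(\<Sum>i=1..n. x i * P (s i)) \<le> (\<Sum>i=1..n. x i * sqrt (f (s i)))"
      by (intro sum_mono mult_left_mono P_le_sqrt_f x that le1[of s]) auto
    also have "\<dots> \<le> R" by (rule R[OF that])
    finally show ?thesis .
  qed
  have xR: "x i \<le> R" if i: "i \<in> ?I" for i
  proof -
    have "(\<Sum>j=1..n. x j * sqrt (f (if j = i then 1 else 0))) \<le> R"
      by (rule R) (use i in auto)
    moreover have "(\<Sum>j=1..n. x j * sqrt (f (if j = i then 1 else 0)))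
        = (\<Sum>j=1..n. if j = i then x i else 0)"
      by (intro sum.cong) (auto simp: f_0 f_1)
    ultimately show ?thesis using i by simp
  qed
  define S where "S i = {t. 0 < t \<and> t \<le> 1 \<and> 2 * R < x i * a t}" for i
  \<comment> \<open>Inserting 0 gives an empty level set the supremum 0.\<close>
  define \<sigma> where "\<sigma> i = Sup (insert 0 (S i))" for i
  have bdd: "bdd_above (insert 0 (S i))" for i
    by (rule bdd_aboveI[of _ 1]) (auto simp: S_def)
  have \<sigma>0: "0 \<le> \<sigma> i" for i unfolding \<sigma>_def by (rule cSup_upper[OF _ bdd]) simp
  have \<sigma>1: "\<sigma> i \<le> 1" for i unfolding \<sigma>_def by (rule cSup_least) (auto simp: S_def)
  have above: "x i * a t \<le> 2 * R" if "\<sigma> i < t" "t \<le> 1" for i t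
  proof (rule ccontr)
    assume "\<not> ?thesis"
    then have "t \<in> S i" using that \<sigma>0[of i] by (auto simp: S_def)
    then have "t \<le> \<sigma> i" unfolding \<sigma>_def by (intro cSup_upper[OF _ bdd]) simp
    then show False using that by simp
  qed
  have below: "2 * R \<le> x i * a t" if i: "i \<in> ?I" and t: "0 < t" "t < \<sigma> i" for i t
  proof -
    obtain u where u: "u \<in> insert 0 (S i)" "t < u"
      using t(2) unfolding \<sigma>_def by (metis less_cSup_iff bdd insert_not_empty)
    then have "u \<in> S i" using t by auto
    then have "2 * R < x i * a u" "u \<le> 1" by (auto simp: S_def)
    moreover have "x i * a u \<le> x i * a t"
      using u t \<open>u \<le> 1\<close> x[OF i] by (intro mult_left_mono a_antimono) auto
    ultimately show ?thesis by simp
  qed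
  have \<sigma>P: "2 * R * \<sigma> i \<le> x i * P (\<sigma> i)" if i: "i \<in> ?I" for i
  proof (cases "x i = 0")
    case True
    have "S i = {}" using True R0 by (auto simp: S_def)
    then show ?thesis using True by (simp add: \<sigma>_def)
  next
    case False
    then have xp: "0 < x i" using x[OF i] by simp
    have "(\<sigma> i - 0) * (2 * R / x i) \<le> P (\<sigma> i) - P 0"
      by (rule P_diff_ge) (use \<sigma>0 \<sigma>1 below[OF i] xp in \<open>auto simp: field_simps\<close>)
    then show ?thesis using xp P_0 by (simp add: field_simps)
  qed
  \<comment> \<open>If the levels had sum \<open>\<Theta> > 1\<close>, the levels divided by
    \<open>\<Theta>\<close> would be admissible. By \<open>P_scale\<close> the pairing at them is at
    least \<open>2 R\<close>, against the bound \<open>R\<close>. The case \<open>R = 0\<close> is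
    separate: there all \<open>x i\<close> vanish and all levels are 0.\<close>
  have sum\<sigma>: "(\<Sum>i=1..n. \<sigma> i) \<le> 1"
  proof (rule ccontr)
    define \<Theta> where "\<Theta> = (\<Sum>i=1..n. \<sigma> i)"
    assume "\<not> ?thesis"
    then have \<Theta>: "1 < \<Theta>" by (simp add: \<Theta>_def)
    have "0 < R"
    proof (rule ccontr)
      assume "\<not> 0 < R"
      then have "x i = 0" if "i \<in> ?I" for i using xR[OF that] x[OF that] R0 by simp
      then have "S i = {}" if "i \<in> ?I" for i using that R0 by (auto simp: S_def)
      then have "\<Theta> = 0" unfolding \<Theta>_def by (intro sum.neutral) (simp add: \<sigma>_def)
      then show False using \<Theta> by simp
    qed
    have "2 * R = (\<Sum>i=1..n. (1 / \<Theta>) * (2 * R * \<sigma> i))"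
      unfolding sum_distrib_left[symmetric] \<Theta>_def[symmetric] using \<Theta> by simp
    also have "\<dots> \<le> (\<Sum>i=1..n. (1 / \<Theta>) * (x i * P (\<sigma> i)))"
      using \<Theta> by (intro sum_mono mult_left_mono \<sigma>P) auto
    also have "\<dots> = (\<Sum>i=1..n. x i * ((1 / \<Theta>) * P (\<sigma> i)))" by (simp add: mult_ac)
    also have "\<dots> \<le> (\<Sum>i=1..n. x i * P ((1 / \<Theta>) * \<sigma> i))"
      using \<Theta> \<sigma>0 \<sigma>1 by (intro sum_mono mult_left_mono P_scale x) auto
    also have "\<dots> \<le> R"
    proof (rule RP)
      show "(\<Sum>i=1..n. (1 / \<Theta>) * \<sigma> i) \<le> 1"
        using \<Theta> by (simp only: sum_distrib_left[symmetric] \<Theta>_def[symmetric]) simp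
    qed (use \<sigma>0 \<Theta> in auto)
    finally show False using \<open>0 < R\<close> by simp
  qed
  define k where "k i = cell_of n (\<sigma> i)" for i
  have k: "1 \<le> k i" "k i \<le> n" "\<sigma> i \<le> real (k i) / real n" "real (k i) / real n \<le> \<sigma> i + 1 / real n" for i
    unfolding k_def using cell_of_bounds[of n "\<sigma> i"] n \<sigma>0 \<sigma>1 by auto
  define \<kappa> where "\<kappa> i = real (k i) / real n" for i
  have \<kappa>: "0 < \<kappa> i" "\<kappa> i \<le> 1" "\<sigma> i \<le> \<kappa> i" "\<kappa> i \<le> \<sigma> i + 1 / real n" for i
    using k[of i] by (auto simp: \<kappa>_def)
  \<comment> \<open>The rounded levels sum to at most 2. Halving them makes them admissible and, by
    \<open>P_scale\<close>, costs a factor 2.\<close>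
  have l1: "(\<Sum>i=1..n. x i * P (\<kappa> i)) \<le> 2 * R"
  proof -
    have "(\<Sum>i=1..n. x i * P (\<kappa> i)) \<le> (\<Sum>i=1..n. 2 * (x i * P ((1/2) * \<kappa> i)))"
    proof (rule sum_mono)
      fix i assume i: "i \<in> ?I"
      have "(1/2) * P (\<kappa> i) \<le> P ((1/2) * \<kappa> i)" using \<kappa>[of i] by (intro P_scale) auto
      then have "x i * ((1/2) * P (\<kappa> i)) \<le> x i * P ((1/2) * \<kappa> i)"
        using x[OF i] by (rule mult_left_mono)
      then show "x i * P (\<kappa> i) \<le> 2 * (x i * P ((1/2) * \<kappa> i))" by simp
    qed
    also have "\<dots> = 2 * (\<Sum>i=1..n. x i * P ((1/2) * \<kappa> i))" by (simp only: sum_distrib_left)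
    also have "\<dots> \<le> 2 * R"
    proof (intro mult_left_mono RP)
      have "(\<Sum>i=1..n. \<kappa> i) \<le> (\<Sum>i=1..n. \<sigma> i + 1 / real n)" by (intro sum_mono \<kappa>)
      also have "\<dots> \<le> 2" using sum\<sigma> n by (simp add: sum.distrib)
      finally show "(\<Sum>i=1..n. (1/2) * \<kappa> i) \<le> 1" by (simp add: sum_divide_distrib[symmetric])
      show "0 \<le> (1/2) * \<kappa> i" for i using \<kappa>(1)[of i] by simp
    qed auto
    finally show ?thesis .
  qed
  define b where "b i = Q (\<kappa> i)" for i
  have b0: "0 \<le> b i" for i unfolding b_def using \<kappa>[of i] by (intro Q_nonneg) auto
  define W where "W = (\<Sum>i=1..n. (x i)\<^sup>2 * b i)"
  define V where "V = sqrt W"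
  have W0: "0 \<le> W" unfolding W_def using b0 by (intro sum_nonneg) auto
  have V2: "V\<^sup>2 = W" unfolding V_def using W0 by simp
  \<comment> \<open>If \<open>V > 2 R\<close>, the bound is tested with masses proportional to the
    shares of the coordinates in \<open>V\<^sup>2\<close>. Each coordinate then yields at least half
    of \<open>(x i)\<^sup>2 * b i / V\<close>, so the pairing is at least \<open>V / 2\<close>,
    which exceeds \<open>R\<close>.\<close>
  have l2: "V \<le> 2 * R"
  proof (rule ccontr)
    assume "\<not> ?thesis"
    then have V: "2 * R < V" by simp
    then have Vp: "0 < V" using R0 by simp
    define s where "s i = (x i)\<^sup>2 * b i / V\<^sup>2" for i
    have s0: "0 \<le> s i" for i unfolding s_def using b0 by simp
    have ssum: "(\<Sum>i=1..n. s i) = 1"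
      unfolding s_def sum_divide_distrib[symmetric] W_def[symmetric] V2 using V2 Vp by auto
    have s1: "s i \<le> 1" if "i \<in> ?I" for i using le1[of s] that s0 ssum by simp
    have main: "(x i)\<^sup>2 * b i / (2 * V) \<le> x i * sqrt (f (s i))" if i: "i \<in> ?I" for i
    proof (cases "s i = 0")
      case True
      then show ?thesis using Vp f_0 by (auto simp: s_def)
    next
      case False
      then have sp: "0 < s i" using s0[of i] by simp
      have xp: "0 < x i" using False x[OF i] by (cases "x i = 0") (auto simp: s_def)
      \<comment> \<open>If at least half of the tail \<open>b i\<close> survives beyond
        \<open>s i\<close>, the summand \<open>s Q\<close> of \<open>f\<close> alone
        suffices.\<close>
      have half: "(x i)\<^sup>2 * b i / (2 * V) \<le> x i * sqrt (f (s i))" if h: "b i / 2 \<le> Q (s i)"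
      proof -
        have "(x i * b i / (2 * V))\<^sup>2 = s i * (b i / 4)"
          unfolding s_def using Vp by (simp add: power2_eq_square field_simps)
        also have "\<dots> \<le> s i * Q (s i)"
          using h b0[of i] s0[of i] by (intro mult_left_mono) auto
        also have "\<dots> \<le> f (s i)" using f_eq[OF sp s1[OF i]] by simp
        finally have "x i * b i / (2 * V) \<le> sqrt (f (s i))" by (rule real_le_rsqrt)
        then have "x i * (x i * b i / (2 * V)) \<le> x i * sqrt (f (s i))"
          using xp by (intro mult_left_mono) auto
        then show ?thesis by (simp add: power2_eq_square mult_ac)
      qed
      show ?thesis
      proof (cases "s i \<le> \<kappa> i")
        case True
        then have "b i \<le> Q (s i)" unfolding b_def using sp \<kappa>[of i] by (intro Q_antimono)
        then show ?thesis using b0[of i] by (intro half) simp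
      next
        case False
        then have \<kappa>s: "\<kappa> i \<le> s i" by simp
        show ?thesis
        proof (cases "b i / 2 \<le> Q (s i)")
          case False
          \<comment> \<open>Now more than half of the tail lies between \<open>\<kappa> i\<close>
            and \<open>s i\<close>. There \<open>x i * a \<le> 2 * R < V\<close>, so the integral of
            \<open>a\<^sup>2\<close> is controlled by that of \<open>a\<close>, and the summand
            \<open>P\<^sup>2\<close> of \<open>f\<close> suffices.\<close>
          have 1: "((\<lambda>u. x i * (a u)\<^sup>2) has_integral x i * (Q (\<kappa> i) - Q (s i))) {\<kappa> i..s i}"
            using \<kappa>[of i] \<kappa>s s1[OF i] by (intro has_integral_mult_right a_sq_has_integral)
          have 2: "((\<lambda>u. 2 * R * a u) has_integral 2 * R * (P (s i) - P (\<kappa> i))) {\<kappa> i..s i}"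
            using \<kappa>[of i] \<kappa>s s1[OF i] by (intro has_integral_mult_right a_has_integral) auto
          have 3: "x i * (a u)\<^sup>2 \<le> 2 * R * a u" if u: "\<kappa> i < u" "u \<le> s i" for u
          proof -
            have "x i * a u \<le> 2 * R" using u \<kappa>[of i] s1[OF i] by (intro above) auto
            moreover have "0 \<le> a u" using u \<kappa>[of i] s1[OF i] by (intro a_nonneg) auto
            ultimately have "(x i * a u) * a u \<le> 2 * R * a u" by (rule mult_right_mono)
            then show ?thesis by (simp add: power2_eq_square)
          qed
          \<comment> \<open>The left end is modified because \<open>\<kappa> i\<close> may equal
            \<open>\<sigma> i\<close>, where \<open>above\<close> says nothing.\<close>
          define h where "h u = (if u = \<kappa> i then 2 * R * a u else x i * (a u)\<^sup>2)" for u
          have "(h has_integral x i * (Q (\<kappa> i) - Q (s i))) {\<kappa> i..s i}"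
            by (rule has_integral_spike_finite[OF _ _ 1, where S="{\<kappa> i}"]) (auto simp: h_def)
          then have "x i * (Q (\<kappa> i) - Q (s i)) \<le> 2 * R * (P (s i) - P (\<kappa> i))"
            by (rule has_integral_le[OF _ 2]) (use 3 in \<open>auto simp: h_def\<close>)
          also have "\<dots> \<le> 2 * R * P (s i)"
            using R0 P_nonneg[of "\<kappa> i"] \<kappa>[of i] by (intro mult_left_mono) auto
          also have "\<dots> \<le> V * P (s i)"
            using V P_nonneg[of "s i"] s0 s1[OF i] by (intro mult_right_mono) auto
          finally have "x i * (b i - Q (s i)) \<le> V * P (s i)" unfolding b_def .
          moreover have "x i * (b i / 2) \<le> x i * (b i - Q (s i))"
            using False xp by (intro mult_left_mono) auto
          ultimately have "x i * b i / (2 * V) \<le> P (s i)"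
            using Vp by (simp add: field_simps)
          also have "\<dots> \<le> sqrt (f (s i))" using s0 s1[OF i] by (intro P_le_sqrt_f)
          finally have "x i * (x i * b i / (2 * V)) \<le> x i * sqrt (f (s i))"
            using xp by (intro mult_left_mono) auto
          then show ?thesis by (simp add: power2_eq_square mult_ac)
        qed (rule half)
      qed
    qed
    have "V / 2 = (\<Sum>i=1..n. (x i)\<^sup>2 * b i / (2 * V))"
      unfolding sum_divide_distrib[symmetric] W_def[symmetric] V2[symmetric]
      using Vp by (simp add: power2_eq_square)
    also have "\<dots> \<le> (\<Sum>i=1..n. x i * sqrt (f (s i)))" by (intro sum_mono main)
    also have "\<dots> \<le> R" using s0 ssum by (intro R) auto
    finally show False using V by simp
  qed
  have "perm_avg n (cell_mean n) x
    \<le> (\<Sum>i=1..n. x i * ((1 / real n) * (\<Sum>l=1..k i. cell_mean n l)))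
     + sqrt (\<Sum>i=1..n. (x i)\<^sup>2 * ((1 / real n) * (\<Sum>l=Suc (k i)..n. (cell_mean n l)\<^sup>2)))"
    by (rule perm_avg_le) (use x k cell_mean_nonneg in auto)
  also have "(\<Sum>i=1..n. x i * ((1 / real n) * (\<Sum>l=1..k i. cell_mean n l)))
      = (\<Sum>i=1..n. x i * P (\<kappa> i))"
    unfolding \<kappa>_def using k n by (simp only: sum_cell_mean)
  also have "sqrt (\<Sum>i=1..n. (x i)\<^sup>2 * ((1 / real n) * (\<Sum>l=Suc (k i)..n. (cell_mean n l)\<^sup>2))) \<le> V"
    unfolding V_def W_def b_def \<kappa>_def
    by (intro real_sqrt_le_mono sum_mono mult_left_mono sum_le_Q k) auto
  finally show ?thesis using l1 l2 by simp
qed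

end

section \<open>The representation of concave squares\<close>

text \<open>Here \<open>p\<close> is the derivative of \<open>f\<close>, and \<open>Z\<close>
  contains the points where a second derivative may fail to exist. The last assumption is Lusin's
  condition for \<open>f - s f'\<close> on \<open>Z\<close>; it prevents this function from growing
  on a null set unseen by \<open>f''\<close>.\<close>

locale concave_square =
  fixes f p :: "real \<Rightarrow> real" and Z :: "real set"
  assumes f_0: "f 0 = 0" and f_1: "f 1 = 1" and f_cont: "continuous_on {0..1} f"
    and f_deriv: "0 < s \<Longrightarrow> s < 1 \<Longrightarrow> (f has_real_derivative p s) (at s)"
    and p_pos: "0 < s \<Longrightarrow> s < 1 \<Longrightarrow> 0 < p s"
    and p_cont: "0 < s \<Longrightarrow> s < 1 \<Longrightarrow> isCont p s"
    and p_strict: "0 < r \<Longrightarrow> r < t \<Longrightarrow> t < 1 \<Longrightarrow> p t < p r"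
    and p_deriv: "0 < s \<Longrightarrow> s < 1 \<Longrightarrow> s \<notin> Z \<Longrightarrow> p field_differentiable (at s)"
    and Z_sub: "Z \<subseteq> {0<..<1}" and Z_null: "negligible Z"
    and Z_image_null: "negligible ((\<lambda>s. f s - s * p s) ` Z)"
begin

text \<open>As \<open>p\<close> decreases, this is its left limit at 1; it turns out to be the left
  derivative of \<open>f\<close> at 1.\<close>

definition L :: real where "L = Inf (p ` {0<..<1})"
text \<open>Continues \<open>p\<close> to 1, so that \<open>D\<close> and \<open>H\<close>, the
  functions \<open>h\<^sup>2\<close> and \<open>h\<close>, live on the closed interval. The
  unspecified value at 0 is harmless, being multiplied by \<open>s = 0\<close> in
  \<open>D\<close>.\<close>

definition p1 :: "real \<Rightarrow> real" where "p1 s = (if s < 1 then p s else L)"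
definition D :: "real \<Rightarrow> real" where "D s = f s - s * p1 s"
definition H :: "real \<Rightarrow> real" where "H s = sqrt (D s)"

lemma p_bdd_below: "bdd_below (p ` {0<..<1})"
  by (rule bdd_belowI[of _ 0]) (use p_pos in \<open>auto intro: less_imp_le\<close>)

lemma L_le: "0 < s \<Longrightarrow> s < 1 \<Longrightarrow> L \<le> p s"
  unfolding L_def by (rule cInf_lower[OF _ p_bdd_below]) auto

lemma L_less:
  assumes "0 < s" "s < 1"
  shows "L < p s"
proof -
  have "L \<le> p ((s + 1) / 2)" using assms by (intro L_le) auto
  also have "\<dots> < p s" using assms by (intro p_strict) auto
  finally show ?thesis .
qed

lemma L_nonneg: "0 \<le> L"
  unfolding L_def by (rule cInf_greatest) (use p_pos in \<open>auto intro: less_imp_le\<close>)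

lemma L_approx:
  assumes "L < x"
  obtains c where "0 < c" "c < 1" "p c < x"
proof -
  have "\<exists>y\<in>p ` {0<..<1}. y < x"
    using assms unfolding L_def by (subst (asm) cInf_less_iff[OF _ p_bdd_below]) auto
  then show thesis using that by auto
qed

lemma p1_strict: "0 < r \<Longrightarrow> r < t \<Longrightarrow> t \<le> 1 \<Longrightarrow> p1 t < p1 r"
  unfolding p1_def using p_strict L_less by auto

lemma f_MVT:
  assumes "0 \<le> r" "r < t" "t \<le> 1"
  obtains z where "r < z" "z < t" "f t - f r = (t - r) * p z"
proof -
  have "\<exists>l z. r < z \<and> z < t \<and> DERIV f z :> l \<and> f t - f r = (t - r) * l"
  proof (rule MVT[OF assms(2)])
    show "continuous_on {r..t} f" using f_cont by (rule continuous_on_subset) (use assms in auto)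
    show "f differentiable (at x)" if "r < x" "x < t" for x
      using f_deriv[of x] that assms by (auto simp: real_differentiable_def)
  qed
  then obtain l z where z: "r < z" "z < t" "DERIV f z :> l" "f t - f r = (t - r) * l" by blast
  moreover have "l = p z" using z assms f_deriv[of z] DERIV_unique by auto
  ultimately show thesis using that by blast
qed

lemma f_strict: "0 \<le> r \<Longrightarrow> r < t \<Longrightarrow> t \<le> 1 \<Longrightarrow> f r < f t"
  by (rule f_MVT[of r t]) (auto, smt (verit) p_pos mult_pos_pos)

lemma f_mono: "0 \<le> r \<Longrightarrow> r \<le> t \<Longrightarrow> t \<le> 1 \<Longrightarrow> f r \<le> f t"
  using f_strict[of r t] by (cases "r = t") auto

lemma D_0: "D 0 = 0"
  unfolding D_def using f_0 by simp

lemma p_ge_p1: "0 < z \<Longrightarrow> z < t \<Longrightarrow> t \<le> 1 \<Longrightarrow> p1 t < p z"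
  using p1_strict[of z t] by (auto simp: p1_def)

text \<open>No derivative of \<open>p\<close> is available, so the mean value theorem is applied to
  \<open>f\<close>: its increment exceeds \<open>(t - r) * p1 t\<close>, and what remains is
  \<open>r * (p1 r - p1 t) \<ge> 0\<close>.\<close>

lemma D_strict:
  assumes "0 \<le> r" "r < t" "t \<le> 1"
  shows "D r < D t"
proof -
  obtain z where z: "r < z" "z < t" "f t - f r = (t - r) * p z"
    using f_MVT[OF assms] .
  have "(t - r) * p1 t < (t - r) * p z"
    using z assms p_ge_p1[of z t] by (intro mult_strict_left_mono) auto
  moreover have "r * p1 t \<le> r * p1 r"
    using assms p1_strict[of r t] by (cases "r = 0") (auto intro!: mult_left_mono)
  ultimately show ?thesis unfolding D_def using z(3) by (simp add: algebra_simps)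
qed

lemma D_pos: "0 < s \<Longrightarrow> s \<le> 1 \<Longrightarrow> 0 < D s"
  using D_strict[of 0 s] D_0 by simp

lemma D_nonneg: "0 \<le> s \<Longrightarrow> s \<le> 1 \<Longrightarrow> 0 \<le> D s"
  using D_pos[of s] D_0 by (cases "s = 0") auto

lemma H_0: "H 0 = 0"
  unfolding H_def using D_0 by simp

lemma H_strict: "0 \<le> r \<Longrightarrow> r < t \<Longrightarrow> t \<le> 1 \<Longrightarrow> H r < H t"
  unfolding H_def using D_strict by simp

lemma H_mono: "0 \<le> r \<Longrightarrow> r \<le> t \<Longrightarrow> t \<le> 1 \<Longrightarrow> H r \<le> H t"
  using H_strict[of r t] by (cases "r = t") auto

lemma H_nonneg: "0 \<le> s \<Longrightarrow> s \<le> 1 \<Longrightarrow> 0 \<le> H s"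
  using H_mono[of 0 s] H_0 by simp

lemma H_sq: "0 \<le> s \<Longrightarrow> s \<le> 1 \<Longrightarrow> (H s)\<^sup>2 = D s"
  unfolding H_def using D_nonneg by simp

lemma H_1: "H 1 = sqrt (1 - L)"
  unfolding H_def D_def p1_def using f_1 by simp

lemma p_tendsto_L: "(p \<longlongrightarrow> L) (at_left 1)"
proof (rule decreasing_tendsto)
  show "\<forall>\<^sub>F s in at_left 1. L \<le> p s"
    unfolding eventually_at_left_field using L_le by (intro exI[of _ 0]) auto
  fix x assume "L < x"
  then obtain c where c: "0 < c" "c < 1" "p c < x" by (rule L_approx)
  show "\<forall>\<^sub>F s in at_left 1. p s < x"
    unfolding eventually_at_left_field
    using c p_strict[of c] by (intro exI[of _ c]) (auto intro: less_trans)
qed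

text \<open>By the mean value theorem every difference quotient at 1 is a value of \<open>p\<close>
  closer to 1, and these values decrease to \<open>L\<close>.\<close>

lemma f_left_derivative: "vector_derivative f (at 1 within {0..1}) = L"
proof (rule vector_derivative_within_closed_interval)
  have "((\<lambda>y. (f y - f 1) / (y - 1)) \<longlongrightarrow> L) (at_left 1)"
  proof (rule decreasing_tendsto)
    have slope: "\<exists>z. s < z \<and> z < 1 \<and> (f s - f 1) / (s - 1) = p z" if s: "0 \<le> s" "s < 1" for s
    proof -
      obtain z where z: "s < z" "z < 1" "f 1 - f s = (1 - s) * p z"
        by (rule f_MVT[of s 1]) (use s in auto)
      have "f s - f 1 = (s - 1) * p z" using z(3) by (simp add: algebra_simps)
      then have "(f s - f 1) / (s - 1) = p z" using s by simp
      then show ?thesis using z by blast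
    qed
    show "\<forall>\<^sub>F y in at_left 1. L \<le> (f y - f 1) / (y - 1)"
      unfolding eventually_at_left_field
    proof (intro exI[of _ 0] conjI allI impI)
      fix y :: real assume "0 < y" "y < 1"
      then show "L \<le> (f y - f 1) / (y - 1)" using slope[of y] L_le by force
    qed simp
    fix x assume "L < x"
    then obtain c where c: "0 < c" "c < 1" "p c < x" by (rule L_approx)
    show "\<forall>\<^sub>F y in at_left 1. (f y - f 1) / (y - 1) < x"
      unfolding eventually_at_left_field
    proof (intro exI[of _ c] conjI allI impI)
      fix y :: real assume y: "c < y" "y < 1"
      then obtain z where "y < z" "z < 1" "(f y - f 1) / (y - 1) = p z" using slope[of y] c by auto
      then show "(f y - f 1) / (y - 1) < x" using p_strict[of c z] c y by auto
    qed (use c in simp)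
  qed
  then show "(f has_vector_derivative L) (at 1 within {0..1})"
    by (simp add: has_real_derivative_iff_has_vector_derivative[symmetric] has_field_derivative_iff
        at_within_Icc_at_left)
qed auto

text \<open>At 0 no bound on \<open>p\<close> is at hand, but \<open>D\<close> is squeezed between 0
  and \<open>f\<close>.\<close>

lemma H_cont: "continuous_on {0..1} H"
proof (rule continuous_on_IccI)
  have fcl: "(f \<longlongrightarrow> f 0) (at_right 0)" "(f \<longlongrightarrow> f 1) (at_left 1)"
    using continuous_on_Icc_at_rightD[OF f_cont] continuous_on_Icc_at_leftD[OF f_cont] by auto
  have "(D \<longlongrightarrow> 0) (at_right 0)"
  proof (rule tendsto_sandwich[OF _ _ tendsto_const[of 0] ])
    show "(f \<longlongrightarrow> 0) (at_right 0)" using fcl f_0 by simp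
    show "\<forall>\<^sub>F s in at_right 0. 0 \<le> D s"
      unfolding eventually_at_right_field using D_nonneg by (intro exI[of _ 1]) auto
    show "\<forall>\<^sub>F s in at_right 0. D s \<le> f s"
      unfolding eventually_at_right_field D_def p1_def using p_pos
      by (intro exI[of _ 1]) (auto intro!: mult_nonneg_nonneg less_imp_le)
  qed
  then show "(H \<longlongrightarrow> H 0) (at_right 0)"
    unfolding H_def D_0 by (rule tendsto_real_sqrt)
  have "((\<lambda>s. f s - s * p s) \<longlongrightarrow> f 1 - 1 * L) (at_left 1)"
    by (intro tendsto_intros fcl p_tendsto_L)
  then have "(D \<longlongrightarrow> D 1) (at_left 1)"
    unfolding D_def
  proof (rule Lim_transform_eventually[of _ _ _ _, THEN back_subst[of "\<lambda>l. (_ \<longlongrightarrow> l) _"]])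
    show "\<forall>\<^sub>F s in at_left 1. f s - s * p s = f s - s * p1 s"
      unfolding eventually_at_left_field p1_def by (intro exI[of _ 0]) auto
  qed (simp add: p1_def)
  then show "(H \<longlongrightarrow> H 1) (at_left 1)"
    unfolding H_def by (rule tendsto_real_sqrt)
  show "H \<midarrow>s\<rightarrow> H s" if s: "0 < s" "s < 1" for s
  proof -
    have "(p \<longlongrightarrow> p s) (at s)" "(f \<longlongrightarrow> f s) (at s)"
      using p_cont[OF s] f_deriv[OF s, THEN DERIV_isCont] by (auto simp: isCont_def)
    then have "((\<lambda>u. sqrt (f u - u * p u)) \<longlongrightarrow> sqrt (f s - s * p s)) (at s)"
      by (intro tendsto_intros)
    moreover have "\<forall>\<^sub>F u in at s. sqrt (f u - u * p u) = H u"
    proof -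
      have "\<forall>\<^sub>F u in at s. u \<in> {..<1}"
        using s by (intro eventually_at_in_open') auto
      then show ?thesis by eventually_elim (simp add: H_def D_def p1_def)
    qed
    ultimately show ?thesis
      using s by (auto simp: H_def D_def p1_def elim: Lim_transform_eventually)
  qed
qed simp

section \<open>The function \<open>H\<close> as the integral of its derivative\<close>

definition j :: "real \<Rightarrow> real" where
  "j s = deriv (deriv f) s / sqrt (f s - s * deriv f s)"

text \<open>At regular points this is \<open>h'(s) / s\<close>. The value 0 elsewhere replaces
  whatever \<open>deriv\<close> returns on \<open>Z\<close> and outside the open interval, which
  affects no integral over \<open>[t, 1]\<close> with \<open>t \<ge> 0\<close> and makes
  \<open>w\<close> nonnegative everywhere.\<close>

definition w :: "real \<Rightarrow> real" where
  "w s = (if s \<in> {0<..<1} - Z then - (1/2) * j s else 0)"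

lemma deriv_f: "0 < s \<Longrightarrow> s < 1 \<Longrightarrow> deriv f s = p s"
  using f_deriv by (rule DERIV_imp_deriv)

lemma H_deriv:
  assumes s: "0 < s" "s < 1" "s \<notin> Z"
  shows "(H has_real_derivative s * w s) (at s)"
proof -
  have "deriv (deriv f) s = deriv p s"
  proof (rule deriv_cong_ev)
    have "\<forall>\<^sub>F u in nhds s. u \<in> {0<..<1}" using s by (intro eventually_nhds_in_open) auto
    then show "\<forall>\<^sub>F u in nhds s. deriv f u = p u" by eventually_elim (simp add: deriv_f)
  qed simp
  moreover have "(p has_real_derivative deriv p s) (at s)"
    using p_deriv[OF s] by (rule field_differentiable_derivI)
  ultimately have p: "(p has_real_derivative deriv (deriv f) s) (at s)" by simp
  define q where "q = deriv (deriv f) s"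
  have D: "D s = f s - s * p s" using s by (simp add: D_def p1_def)
  have Dp: "0 < f s - s * p s" using D_pos[of s] s D by simp
  have "((\<lambda>u. sqrt (f u - u * p u)) has_real_derivative
      (p s - (1 * p s + q * s)) * (inverse (sqrt (f s - s * p s)) / 2)) (at s)"
    using Dp f_deriv[OF s(1,2)] p
    by (auto intro!: derivative_eq_intros simp: q_def field_simps)
  moreover have "(p s - (1 * p s + q * s)) * (inverse (sqrt (f s - s * p s)) / 2) = s * w s"
    using s by (simp add: w_def j_def deriv_f q_def field_simps)
  ultimately have "((\<lambda>u. sqrt (f u - u * p u)) has_real_derivative s * w s) (at s)" by simp
  then show ?thesis
    by (rule has_field_derivative_transform_within_open[where S="{0<..<1}"])
      (use s in \<open>auto simp: H_def D_def p1_def\<close>)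
qed

lemma w_nonneg: "0 \<le> w s"
proof (cases "s \<in> {0<..<1} - Z")
  case True
  have "mono_on {0<..<1} H" by (rule mono_onI) (use H_mono in auto)
  then have "0 \<le> s * w s"
    using True by (intro mono_on_imp_deriv_nonneg[OF _ H_deriv]) auto
  then show ?thesis using True by (simp add: zero_le_mult_iff)
next
  case False
  then show ?thesis unfolding w_def by (simp only: if_False)
qed

lemma H_image_null: "negligible (H ` Z)"
proof -
  have DZ: "D ` Z = (\<lambda>s. f s - s * p s) ` Z"
    using Z_sub by (intro image_cong) (auto simp: D_def p1_def)
  have "negligible (sqrt ` D ` Z)"
  proof (rule negligible_differentiable_image_negligible)
    show "negligible (D ` Z)" unfolding DZ by (rule Z_image_null)
    show "sqrt differentiable_on D ` Z"
      unfolding differentiable_on_def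
    proof
      fix y assume "y \<in> D ` Z"
      then have "0 < y" using D_pos Z_sub by auto
      then show "sqrt differentiable at y within D ` Z"
        using DERIV_real_sqrt[of y]
        by (auto intro: has_field_derivative_at_within simp: real_differentiable_def)
    qed
  qed simp
  then show ?thesis by (simp add: image_image H_def[abs_def])
qed

text \<open>The change of variables by \<open>H\<close> itself, applied to the constant 1, replaces the
  fundamental theorem of calculus, which fails to apply as \<open>H\<close> need not be differentiable on \<open>Z\<close>.\<close>

lemma sw_integral:
  assumes rt: "0 \<le> r" "r \<le> t" "t \<le> 1"
  shows "(\<lambda>s. s * w s) absolutely_integrable_on {r..t}"
    "((\<lambda>s. s * w s) has_integral (H t - H r)) {r..t}"
proof -
  define S where "S = {r<..<t} - Z"
  have S: "S \<in> sets lebesgue"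
    unfolding S_def by (intro sets.Diff negligible_imp_sets[OF Z_null]) simp
  have inj: "inj_on H S"
  proof (rule inj_onI)
    fix u v assume "u \<in> S" "v \<in> S" "H u = H v"
    then show "u = v"
      using H_strict[of u v] H_strict[of v u] rt by (cases u v rule: linorder_cases) (auto simp: S_def)
  qed
  have der: "(H has_real_derivative s * w s) (at s within S)" if "s \<in> S" for s
    using H_deriv[of s] that rt by (auto simp: S_def intro: DERIV_subset)
  have HI: "H ` S \<subseteq> {H r..H t}" using H_mono rt by (auto simp: S_def)
  \<comment> \<open>By the intermediate value theorem each value in the interval is attained; those
    not attained on \<open>S\<close> are end values or values on \<open>Z\<close>. So the image of
    \<open>S\<close> has full measure \<open>H t - H r\<close>.\<close>
  have "{H r..H t} - H ` S \<subseteq> {H r, H t} \<union> H ` Z"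
  proof
    fix y assume y: "y \<in> {H r..H t} - H ` S"
    have "continuous_on {r..t} H" by (rule continuous_on_subset[OF H_cont]) (use rt in auto)
    then obtain u where u: "r \<le> u" "u \<le> t" "H u = y"
      using IVT'[of H r y t] y rt by auto
    then show "y \<in> {H r, H t} \<union> H ` Z"
      using y by (cases "u = r \<or> u = t") (auto simp: S_def)
  qed
  then have neg: "negligible ({H r..H t} - H ` S)"
    using H_image_null by (auto intro: negligible_subset[rotated])
  have HI0: "negligible (H ` S - {H r..H t})" using HI by (simp add: Diff_eq_empty_iff[THEN iffD2])
  have "(\<lambda>_. 1::real) absolutely_integrable_on {H r..H t}"
    by (auto intro: absolutely_integrable_on_const)
  then have one_abs: "(\<lambda>_. 1::real) absolutely_integrable_on H ` S"
    by (rule absolutely_integrable_spike_set_eq[THEN iffD1, rotated 2])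
      (rule negligible_subset[OF neg] negligible_subset[OF HI0], blast)+
  have "((\<lambda>_. 1::real) has_integral (H t - H r)) {H r..H t}"
    using has_integral_const_real[of "1::real" "H r" "H t"] H_mono rt by simp
  then have "((\<lambda>_. 1::real) has_integral (H t - H r)) (H ` S)"
    by (rule has_integral_spike_set_eq[THEN iffD1, rotated 2])
      (rule negligible_subset[OF neg] negligible_subset[OF HI0], blast)+
  then have "integral (H ` S) (\<lambda>_. 1::real) = H t - H r" by (rule integral_unique)
  with one_abs have *: "(\<lambda>s. \<bar>s * w s\<bar> * 1) absolutely_integrable_on S \<and>
      integral S (\<lambda>s. \<bar>s * w s\<bar> * 1) = H t - H r"
    using has_absolute_integral_change_of_variables_1'[OF S der inj, of "\<lambda>_. 1" "H t - H r"] by blast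
  have abs: "\<bar>s * w s\<bar> * 1 = s * w s" if "s \<in> S" for s
    using that w_nonneg[of s] rt by (simp add: S_def abs_mult)
  have absS: "(\<lambda>s. s * w s) absolutely_integrable_on S"
    using * abs by (metis (no_types, lifting) absolutely_integrable_spike negligible_empty DiffD1)
  have intS: "((\<lambda>s. s * w s) has_integral (H t - H r)) S"
    using * abs absS by (metis (no_types, lifting) Henstock_Kurzweil_Integration.integral_cong
        integrable_integral set_lebesgue_integral_eq_integral(1))
  have neg2: "negligible ({r..t} - S)"
    by (rule negligible_subset[of "{r, t} \<union> Z"]) (use Z_null in \<open>auto simp: S_def\<close>)
  have S0: "negligible (S - {r..t})"
    by (rule negligible_subset[OF negligible_empty]) (auto simp: S_def)
  show "(\<lambda>s. s * w s) absolutely_integrable_on {r..t}"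
    using absS by (rule absolutely_integrable_spike_set_eq[THEN iffD1, rotated 2])
      (rule negligible_subset[OF neg2] negligible_subset[OF S0], blast)+
  show "((\<lambda>s. s * w s) has_integral (H t - H r)) {r..t}"
    using intS by (rule has_integral_spike_set_eq[THEN iffD1, rotated 2])
      (rule negligible_subset[OF neg2] negligible_subset[OF S0], blast)+
qed

text \<open>Away from 0 the factor \<open>1 / u\<close> is bounded, so integrability passes from
  \<open>u * w u\<close> to \<open>w\<close>.\<close>

lemma w_integrable:
  assumes "0 < t" "t \<le> 1"
  shows "w integrable_on {t..1}"
proof -
  have "(\<lambda>u. (1 / u) * (u * w u)) absolutely_integrable_on {t..1}"
  proof (rule absolutely_integrable_bounded_measurable_product_real)
    show "(\<lambda>u. 1 / u) \<in> borel_measurable (lebesgue_on {t..1})"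
      by (intro continuous_imp_measurable_on_sets_lebesgue continuous_intros) (use assms in auto)
    have "(\<lambda>u. 1 / u) ` {t..1} \<subseteq> {0..1 / t}" using assms by (auto simp: frac_le)
    then show "bounded ((\<lambda>u. 1 / u) ` {t..1})" by (rule bounded_subset[rotated]) simp
    show "(\<lambda>u. u * w u) absolutely_integrable_on {t..1}" using assms by (intro sw_integral) auto
  qed simp
  then have "(\<lambda>u. (1 / u) * (u * w u)) integrable_on {t..1}"
    by (rule set_lebesgue_integral_eq_integral(1))
  then show ?thesis
    by (rule integrable_eq) (use assms in auto)
qed

section \<open>Recovering the decreasing profile from \<open>f\<close>\<close>

definition a :: "real \<Rightarrow> real" where "a t = integral {t..1} w + 1 - H 1"
text \<open>The outcome of integration by parts serves as definition, so that integrability of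
  \<open>a\<close> up to 0 need not be known beforehand.\<close>

definition P :: "real \<Rightarrow> real" where "P t = t * a t + H t"
definition Q :: "real \<Rightarrow> real" where "Q t = integral {t..1} (\<lambda>u. (a u)\<^sup>2)"

lemma a_eq:
  assumes "0 \<le> t"
  shows "a t = - (1/2) * integral {t..1} j + 1 - sqrt (1 - vector_derivative f (at 1 within {0..1}))"
proof -
  have "integral {t..1} w = integral {t..1} (\<lambda>u. - (1/2) * j u)"
    by (rule integral_spike[of "Z \<union> {0, 1}"]) (use assms Z_null in \<open>auto simp: w_def\<close>)
  then show ?thesis unfolding a_def H_1 f_left_derivative by simp
qed

text \<open>An integrated form of \<open>h' = - s a'\<close>: on \<open>[r, t]\<close> the factor
  \<open>s\<close> in \<open>s * w s\<close> lies between \<open>r\<close> and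
  \<open>t\<close>.\<close>

lemma a_diff:
  assumes rt: "0 < r" "r \<le> t" "t \<le> 1"
  shows "r * (a r - a t) \<le> H t - H r" "H t - H r \<le> t * (a r - a t)" "a t \<le> a r"
proof -
  have i: "w integrable_on {r..1}" using rt by (intro w_integrable) auto
  have e: "a r - a t = integral {r..t} w"
    unfolding a_def using Henstock_Kurzweil_Integration.integral_combine[OF rt(2,3) i] by simp
  have "w integrable_on {r..t}" by (rule integrable_on_subinterval[OF i]) (use rt in auto)
  then have w: "(w has_integral (a r - a t)) {r..t}" unfolding e by (rule integrable_integral)
  have k: "((\<lambda>s. s * w s) has_integral (H t - H r)) {r..t}" using rt by (intro sw_integral) auto
  show "r * (a r - a t) \<le> H t - H r"
    by (rule has_integral_le[OF has_integral_mult_right[OF w] k])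
      (auto intro!: mult_right_mono w_nonneg)
  show "H t - H r \<le> t * (a r - a t)"
    by (rule has_integral_le[OF k has_integral_mult_right[OF w]])
      (auto intro!: mult_right_mono w_nonneg)
  show "a t \<le> a r" using has_integral_nonneg[OF w] w_nonneg by simp
qed

lemma a_1: "a 1 = 1 - H 1"
  unfolding a_def by simp

lemma a_nonneg: "0 < t \<Longrightarrow> t \<le> 1 \<Longrightarrow> 0 \<le> a t"
  using a_diff(3)[of t 1] a_1 H_1 L_nonneg real_sqrt_le_1_iff[of "1 - L"] by linarith

lemma a_cont: 
  assumes "0 < c"
  shows "continuous_on {c..1} a"
proof (cases "c \<le> 1")
  case True
  then show ?thesis unfolding a_def
    by (intro continuous_intros indefinite_integral_continuous_1' w_integrable assms)
qed simp

lemma a_isCont: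
  assumes "0 < s" "s < 1"
  shows "isCont a s"
proof -
  have "continuous_on {s/2..1} a" by (rule a_cont) (use assms in simp)
  then show ?thesis by (rule continuous_on_interior) (use assms in simp)
qed

lemma P_0: "P 0 = 0" unfolding P_def using H_0 by simp
lemma P_1: "P 1 = 1" unfolding P_def a_1 by simp

lemma P_diff:
  assumes "0 < r" "r \<le> t" "t \<le> 1"
  shows "(t - r) * a t \<le> P t - P r" "P t - P r \<le> (t - r) * a r"
  using a_diff[OF assms] unfolding P_def by (auto simp: algebra_simps)

text \<open>The product rule is not applicable, since \<open>a\<close> and \<open>H\<close> need not
  be differentiable. By \<open>P_diff\<close> the difference quotient lies between
  \<open>a y\<close> and \<open>a s\<close>, and \<open>a\<close> is continuous.\<close>

lemma P_deriv:
  assumes s: "0 < s" "s < 1"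
  shows "(P has_real_derivative a s) (at s)"
  unfolding has_field_derivative_iff
proof (rule LIM_zero_cancel, rule Lim_null_comparison)
  have "((\<lambda>y. \<bar>a y - a s\<bar>) \<longlongrightarrow> \<bar>a s - a s\<bar>) (at s)"
    using a_isCont[OF s] by (intro tendsto_intros) (simp add: isCont_def)
  then show "((\<lambda>y. \<bar>a y - a s\<bar>) \<longlongrightarrow> 0) (at s)" by simp
  have "\<forall>\<^sub>F y in at s. y \<in> {0<..<1} - {s}" using s by (intro eventually_at_in_open) auto
  then show "\<forall>\<^sub>F y in at s. norm ((P y - P s) / (y - s) - a s) \<le> \<bar>a y - a s\<bar>"
  proof eventually_elim
    case (elim y)
    show ?case
    proof (cases "y < s")
      case True
      have *: "(s - y) * a s \<le> P s - P y" "P s - P y \<le> (s - y) * a y"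
        using P_diff[of y s] True elim s by auto
      have "(P y - P s) / (y - s) = (P s - P y) / (s - y)"
        by (metis minus_diff_eq minus_divide_divide)
      moreover have "a s \<le> (P s - P y) / (s - y)" "(P s - P y) / (s - y) \<le> a y"
        using * True by (auto simp: field_simps)
      ultimately show ?thesis by simp
    next
      case False
      then have y: "s < y" using elim by auto
      have *: "(y - s) * a y \<le> P y - P s" "P y - P s \<le> (y - s) * a s"
        using P_diff[of s y] y elim s by auto
      have "a y \<le> (P y - P s) / (y - s)" "(P y - P s) / (y - s) \<le> a s"
        using * y by (auto simp: field_simps)
      then show ?thesis by simp
    qed
  qed
qed

text \<open>The delicate point is 0. For \<open>r < d\<close>, \<open>a_diff\<close> gives
  \<open>P r \<le> r * a d + H d\<close>; choosing \<open>d\<close> small, and \<open>r\<close>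
  small depending on \<open>d\<close>, makes this small.\<close>

lemma P_cont: "continuous_on {0..1} P"
proof (rule continuous_on_IccI)
  have Hlim: "(H \<longlongrightarrow> 0) (at_right 0)"
    using continuous_on_Icc_at_rightD[OF H_cont] H_0 by simp
  show "(P \<longlongrightarrow> P 0) (at_right 0)"
    unfolding P_0
  proof (rule decreasing_tendsto)
    show "\<forall>\<^sub>F r in at_right 0. 0 \<le> P r"
      unfolding eventually_at_right_field P_def
      using a_nonneg H_nonneg by (intro exI[of _ 1]) auto
    fix x :: real assume x: "0 < x"
    have "\<forall>\<^sub>F d in at_right 0. H d < x \<and> d \<in> {0<..<1}"
      using order_tendstoD(2)[OF Hlim x]
      by (rule eventually_conj) (rule eventually_at_rightI[of 0 1], auto)
    then obtain d where d: "H d < x" "0 < d" "d < 1"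
      using eventually_happens'[of "at_right (0::real)"] by fastforce
    have "((\<lambda>r. r * a d + H d) \<longlongrightarrow> 0 * a d + H d) (at_right 0)" by (intro tendsto_intros)
    then have "\<forall>\<^sub>F r in at_right 0. r * a d + H d < x"
      using d by (intro order_tendstoD(2)) auto
    moreover have "\<forall>\<^sub>F r in at_right 0. r \<in> {0<..<d}"
      using d by (intro eventually_at_rightI[of 0 d]) auto
    ultimately show "\<forall>\<^sub>F r in at_right 0. P r < x"
    proof eventually_elim
      case (elim r)
      have "r * (a r - a d) \<le> H d - H r" using elim d by (intro a_diff) auto
      then show ?case using elim by (simp add: P_def algebra_simps)
    qed
  qed
  have "continuous_on {1/2..1} P" unfolding P_def
    by (intro continuous_intros a_cont continuous_on_subset[OF H_cont]) auto
  then show "(P \<longlongrightarrow> P 1) (at_left 1)"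
    by (rule continuous_on_Icc_at_leftD) simp
  show "P \<midarrow>s\<rightarrow> P s" if "0 < s" "s < 1" for s
    using P_deriv[OF that, THEN DERIV_isCont] by (simp add: isCont_def)
qed simp

lemma a_has_integral:
  assumes "0 \<le> r" "r \<le> t" "t \<le> 1"
  shows "(a has_integral (P t - P r)) {r..t}"
proof (rule fundamental_theorem_of_calculus_interior[OF assms(2)])
  show "continuous_on {r..t} P" by (rule continuous_on_subset[OF P_cont]) (use assms in auto)
  show "(P has_vector_derivative a x) (at x)" if "x \<in> {r<..<t}" for x
    using P_deriv[of x] that assms by (simp add: has_real_derivative_iff_has_vector_derivative)
qed

lemma a_sq_integrable:
  assumes "0 < r"
  shows "(\<lambda>u. (a u)\<^sup>2) integrable_on {r..1}"
  by (intro integrable_continuous_real continuous_intros a_cont assms)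

lemma a_sq_has_integral:
  assumes "0 < r" "r \<le> t" "t \<le> 1"
  shows "((\<lambda>u. (a u)\<^sup>2) has_integral (Q r - Q t)) {r..t}"
proof -
  have i: "(\<lambda>u. (a u)\<^sup>2) integrable_on {r..1}" by (rule a_sq_integrable[OF assms(1)])
  have "Q r - Q t = integral {r..t} (\<lambda>u. (a u)\<^sup>2)"
    unfolding Q_def using Henstock_Kurzweil_Integration.integral_combine[OF assms(2,3) i] by simp
  moreover have "(\<lambda>u. (a u)\<^sup>2) integrable_on {r..t}"
    by (rule integrable_on_subinterval[OF i]) (use assms in auto)
  ultimately show ?thesis by (simp add: integrable_integral)
qed

lemma Q_1: "Q 1 = 0"
  unfolding Q_def by simp

lemma f_eq:
  assumes s: "0 < s" "s \<le> 1"
  shows "f s = (P s)\<^sup>2 + s * Q s"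
proof (cases "s = 1")
  case True
  then show ?thesis using f_1 P_1 Q_1 by simp
next
  case False
  then have s1: "s < 1" using s by simp
  define \<Phi> where "\<Phi> t = f t / t - (P t)\<^sup>2 / t - Q t" for t
  have cont: "continuous_on {s..1} (\<lambda>u. (a u)\<^sup>2)"
    by (intro continuous_intros a_cont s)
  have Qd: "(Q has_real_derivative - (a t)\<^sup>2) (at t)" if t: "s < t" "t < 1" for t
  proof -
    have "(Q has_real_derivative - (a t)\<^sup>2) (at t within {s..1})"
      unfolding Q_def using integral_has_real_derivative'[OF cont, of t] t by simp
    then show ?thesis using t at_within_Icc_at[of s t 1] by simp
  qed
  have "\<Phi> 1 = \<Phi> s"
  proof (rule DERIV_isconst_end[OF s1])
    have "continuous_on {s..1} Q"
      unfolding Q_def by (rule indefinite_integral_continuous_1'[OF a_sq_integrable[OF s(1)]])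
    moreover have "continuous_on {s..1} f" "continuous_on {s..1} P"
      using s by (auto intro: continuous_on_subset[OF f_cont] continuous_on_subset[OF P_cont])
    ultimately show "continuous_on {s..1} \<Phi>"
      unfolding \<Phi>_def using s by (intro continuous_intros) auto
    fix t assume t: "s < t" "t < 1"
    have tp: "0 < t" using s t by simp
    have "(\<Phi> has_real_derivative
        (p t * t - f t * 1) / (t * t) - (2 * P t * a t * t - (P t)\<^sup>2 * 1) / (t * t) - - (a t)\<^sup>2) (at t)"
      unfolding \<Phi>_def
      by (rule DERIV_diff DERIV_divide f_deriv Qd DERIV_ident derivative_eq_intros P_deriv
          | use tp t in \<open>simp add: power2_eq_square\<close>)+
    moreover have "(p t * t - f t * 1) / (t * t) - (2 * P t * a t * t - (P t)\<^sup>2 * 1) / (t * t) - - (a t)\<^sup>2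
       = ((P t - t * a t)\<^sup>2 - (f t - t * p t)) / (t * t)"
      using tp by (simp add: field_simps power2_eq_square)
    moreover have "P t - t * a t = H t" by (simp add: P_def)
    moreover have "f t - t * p t = (H t)\<^sup>2"
      using H_sq[of t] tp t by (simp add: D_def p1_def)
    ultimately show "(\<Phi> has_real_derivative 0) (at t)" by simp
  qed
  then have "f s / s - (P s)\<^sup>2 / s - Q s = 0" unfolding \<Phi>_def using f_1 P_1 Q_1 by simp
  then show ?thesis using s by (simp add: field_simps)
qed

sublocale decreasing_profile a P Q f
proof
  show "\<And>r t. 0 < r \<Longrightarrow> r \<le> t \<Longrightarrow> t \<le> 1 \<Longrightarrow> a t \<le> a r" by (rule a_diff(3))
qed (fact a_nonneg a_has_integral a_sq_has_integral P_0 Q_1 f_0 f_1 f_mono f_eq)+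

end

section \<open>Strictly 2-concave Orlicz functions\<close>

lemma strictly_convex_on_imp_convex_on:
  assumes "strictly_convex_on S f"
  shows "convex_on S f"
proof (rule convex_onI)
  show "convex S" using assms by (simp add: strictly_convex_on_def)
  fix t :: real and x y assume "0 < t" "t < 1" "x \<in> S" "y \<in> S"
  then show "f ((1 - t) *\<^sub>R x + t *\<^sub>R y) \<le> (1 - t) * f x + t * f y"
  proof (cases "x = y")
    case True
    then show ?thesis by (simp add: scaleR_left.add[symmetric] algebra_simps)
  next
    case False
    then show ?thesis
      using assms \<open>0 < t\<close> \<open>t < 1\<close> \<open>x \<in> S\<close> \<open>y \<in> S\<close>
      unfolding strictly_convex_on_def by (intro less_imp_le) auto
  qed
qed

text \<open>Both tangents lie below \<open>f\<close> at the midpoint, where \<open>f\<close> is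
  strictly below the chord; comparing the three values separates the slopes.\<close>

lemma strictly_convex_on_deriv_less:
  fixes f :: "real \<Rightarrow> real"
  assumes f: "strictly_convex_on S f" and xy: "x \<in> interior S" "y \<in> interior S" "x < y"
    and d: "(f has_real_derivative a) (at x)" "(f has_real_derivative b) (at y)"
  shows "a < b"
proof -
  define z where "z = (x + y) / 2"
  have S: "x \<in> S" "y \<in> S" using xy interior_subset by auto
  have cvx: "convex_on S f" by (rule strictly_convex_on_imp_convex_on[OF f])
  have conv: "convex S" using f by (simp add: strictly_convex_on_def)
  have z: "z = (1/2) *\<^sub>R x + (1/2) *\<^sub>R y" by (simp add: z_def field_simps)
  have zS: "z \<in> S" unfolding z using S conv by (intro convexD) auto
  have "\<forall>u>0. \<forall>v>0. x \<noteq> y \<longrightarrow> u + v = 1 \<longrightarrow>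
      f (u *\<^sub>R x + v *\<^sub>R y) < u * f x + v * f y"
    using f S unfolding strictly_convex_on_def by blast
  from this[rule_format, of "1/2" "1/2"] have "f z < 1/2 * f x + 1/2 * f y"
    unfolding z using xy(3) by simp
  moreover have "a * (z - x) \<le> f z - f x"
    by (rule convex_on_imp_above_tangent[OF cvx convex_connected[OF conv] xy(1) zS])
      (rule has_field_derivative_at_within[OF d(1)])
  moreover have "b * (z - y) \<le> f z - f y"
    by (rule convex_on_imp_above_tangent[OF cvx convex_connected[OF conv] xy(2) zS])
      (rule has_field_derivative_at_within[OF d(2)])
  ultimately have "a * (y - x) < b * (y - x)" unfolding z_def by (simp add: field_simps)
  then show ?thesis using xy(3) by simp
qed

section \<open>The derivative of \<open>M\<close> and its inverse\<close>

locale two_concave_orlicz =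
  fixes M :: "real \<Rightarrow> real"
  assumes orlicz: "orlicz_function M" and strict: "strictly_convex_on UNIV M"
    and diff: "twice_differentiable M" and conc: "strictly_2_concave M"
    and norm: "orlicz_dual M 1 = 1" and regular: "dual_inv_sq_regular M"
begin

definition m :: "real \<Rightarrow> real" where "m = deriv M"

lemma M_deriv: "(M has_real_derivative m t) (at t)"
  using diff unfolding twice_differentiable_def m_def by (simp add: DERIV_deriv_iff_real_differentiable)

lemma m_deriv: "(m has_real_derivative deriv m t) (at t)"
  using diff unfolding twice_differentiable_def m_def by (simp add: DERIV_deriv_iff_real_differentiable)

lemma m_isCont: "isCont m t"
  using m_deriv by (rule DERIV_isCont)

lemma m_strict: "x < y \<Longrightarrow> m x < m y"
  by (rule strictly_convex_on_deriv_less[OF strict _ _ _ M_deriv M_deriv]) auto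

lemma m_0: "m 0 = 0"
proof (rule DERIV_local_min[OF M_deriv])
  have "M 0 \<le> M y" for y
    using orlicz unfolding orlicz_function_def by (cases "y = 0") (auto intro: less_imp_le)
  then show "\<forall>y. \<bar>0 - y\<bar> < 1 \<longrightarrow> M 0 \<le> M y" by blast
qed simp

lemma m_pos: "0 < t \<Longrightarrow> 0 < m t"
  using m_strict[of 0 t] m_0 by simp

text \<open>The derivative of \<open>M (sqrt u)\<close> at \<open>u = t\<^sup>2\<close> is
  \<open>m t / (2 * t)\<close>, and derivatives of strictly concave functions decrease
  strictly.\<close>

lemma m_ratio_strict:
  assumes "0 < r" "r < t"
  shows "m t / t < m r / r"
proof -
  have sc: "strictly_convex_on {0..} (\<lambda>u. - M (sqrt u))"
    using conc unfolding strictly_2_concave_def strictly_concave_on_def .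
  have d: "((\<lambda>u. - M (sqrt u)) has_real_derivative - (m t / (2 * t))) (at (t\<^sup>2))" if "0 < t" for t
  proof -
    have "((\<lambda>u. - M (sqrt u)) has_real_derivative - (m (sqrt (t\<^sup>2)) * (inverse (sqrt (t\<^sup>2)) / 2))) (at (t\<^sup>2))"
      using that by (intro DERIV_minus DERIV_chain2[OF M_deriv] DERIV_real_sqrt) simp
    then show ?thesis using that by (simp add: field_simps)
  qed
  have "- (m r / (2 * r)) < - (m t / (2 * t))"
    by (rule strictly_convex_on_deriv_less[OF sc _ _ _ d d])
      (use assms in \<open>auto intro!: power_strict_mono\<close>)
  then show ?thesis by simp
qed

definition \<iota> :: "real \<Rightarrow> real" where "\<iota> = inv_into {0<..} m"

lemma \<iota>_m: "0 < t \<Longrightarrow> \<iota> (m t) = t"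
  unfolding \<iota>_def using m_strict
  by (intro inv_into_f_f inj_onI) (auto, metis linorder_less_linear order_less_irrefl)

lemma inverse_deriv_eq:
  "inverse_deriv M s = (if s \<in> m ` {0<..} then ennreal (\<iota> s) else \<infinity>)"
  unfolding inverse_deriv_def m_def \<iota>_def ..

lemma m_image_down:
  assumes "z \<in> m ` {0<..}" "0 < y" "y \<le> z"
  shows "y \<in> m ` {0<..}"
proof -
  obtain t where t: "0 < t" "z = m t" using assms by auto
  have "\<exists>u\<ge>0. u \<le> t \<and> m u = y"
    by (rule IVT') (use t assms m_0 m_isCont in \<open>auto intro: continuous_at_imp_continuous_on\<close>)
  then obtain u where "0 \<le> u" "m u = y" by blast
  then show ?thesis using m_0 assms by (cases "u = 0") auto
qed

text \<open>Otherwise \<open>inverse_deriv\<close> would be infinite on a nontrivial part of \<open>[0, 1]\<close>,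
  contradicting \<open>M*(1) = 1\<close>.\<close>

lemma unit_in_image:
  assumes y: "0 < y" "y < 1"
  shows "y \<in> m ` {0<..}"
proof (rule ccontr)
  assume "\<not> ?thesis"
  then have out: "s \<notin> m ` {0<..}" if "y \<le> s" for s using m_image_down[of s y] y that by auto
  have "(\<integral>\<^sup>+ s. \<infinity> * indicator {y..1} s \<partial>lborel) \<le> (\<integral>\<^sup>+ s\<in>{0..\<bar>1\<bar>}. inverse_deriv M s \<partial>lborel)"
    by (intro nn_integral_mono) (use y out in \<open>auto simp: inverse_deriv_eq indicator_def\<close>)
  also have "\<dots> = 1" using norm unfolding orlicz_dual_def .
  finally have "\<infinity> * emeasure lborel {y..1} \<le> 1" by (subst (asm) nn_integral_cmult_indicator) auto
  then show False using y by (simp add: ennreal_top_mult top_unique)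
qed

lemma m_\<iota>: "0 < y \<Longrightarrow> y < 1 \<Longrightarrow> m (\<iota> y) = y"
  unfolding \<iota>_def using unit_in_image by (rule f_inv_into_f)

lemma \<iota>_pos: "y \<in> m ` {0<..} \<Longrightarrow> 0 < \<iota> y"
  unfolding \<iota>_def using inv_into_into[of y m "{0<..}"] by simp

lemma \<iota>_pos': "0 < y \<Longrightarrow> y < 1 \<Longrightarrow> 0 < \<iota> y"
  using \<iota>_pos unit_in_image by blast

lemma \<iota>_strict:
  assumes "0 < x" "x < y" "y \<in> m ` {0<..}"
  shows "\<iota> x < \<iota> y"
proof -
  have "x \<in> m ` {0<..}" using m_image_down[of y x] assms by auto
  then have "m (\<iota> x) = x" "m (\<iota> y) = y" unfolding \<iota>_def using assms by (auto simp: f_inv_into_f)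
  then show ?thesis using m_strict[of "\<iota> y" "\<iota> x"] assms by (metis linorder_neqE_linordered_idom less_asym less_irrefl)
qed

lemma \<iota>_isCont:
  assumes y: "0 < y" "y < 1"
  shows "isCont \<iota> y"
proof -
  have "isCont \<iota> (m (\<iota> y))"
  proof (rule isCont_inverse_function[where f=m and g=\<iota> and x="\<iota> y" and d="\<iota> y / 2"])
    show "0 < \<iota> y / 2" using \<iota>_pos'[OF y] by simp
    show "\<iota> (m z) = z" if "\<bar>z - \<iota> y\<bar> \<le> \<iota> y / 2" for z
      using that \<iota>_pos'[OF y] by (intro \<iota>_m) linarith
  qed (rule m_isCont)
  then show ?thesis using m_\<iota>[OF y] by simp
qed

section \<open>The dual function on the unit interval\<close>

text \<open>A real-valued version of \<open>inverse_deriv\<close> on \<open>[0, 1]\<close>. The end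
  points are cut off: at 0 the inverse is infinite by convention, at 1 it may be infinite.\<close>

definition k :: "real \<Rightarrow> real" where "k s = indicator {0<..<1} s *\<^sub>R \<iota> s"

lemma k_eq: "0 < s \<Longrightarrow> s < 1 \<Longrightarrow> k s = \<iota> s"
  unfolding k_def by simp

lemma k_nonneg: "0 \<le> k s"
  unfolding k_def indicator_def using \<iota>_pos'[of s] by auto

lemma k_measurable [measurable]: "k \<in> borel_measurable borel"
  unfolding k_def[abs_def]
  by (intro borel_measurable_continuous_on_indicator continuous_at_imp_continuous_on)
    (auto intro: \<iota>_isCont)

lemma AE_inverse_deriv:
  "AE s in lborel. s \<in> {0..1} \<longrightarrow> inverse_deriv M s = ennreal (k s)"
proof -
  have "AE s in lborel. s \<noteq> (0::real)" "AE s in lborel. s \<noteq> (1::real)" by (rule AE_lborel_singleton)+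
  then show ?thesis
  proof eventually_elim
    case (elim s)
    then show ?case using unit_in_image[of s] by (auto simp: inverse_deriv_eq k_eq)
  qed
qed

lemma orlicz_dual_k:
  assumes "0 \<le> y" "y \<le> 1"
  shows "orlicz_dual M y = (\<integral>\<^sup>+ s. ennreal (k s * indicator {0..y} s) \<partial>lborel)"
  unfolding orlicz_dual_def
  using AE_inverse_deriv
  by (intro nn_integral_cong_AE, eventually_elim) (use assms in \<open>auto simp: indicator_def\<close>)

lemma orlicz_dual_mono: "0 \<le> x \<Longrightarrow> x \<le> y \<Longrightarrow> orlicz_dual M x \<le> orlicz_dual M y"
  unfolding orlicz_dual_def by (intro nn_integral_mono) (auto simp: indicator_def)

text \<open>Represents the dual function on \<open>[0, 1]\<close>, where it is at most 1; an
  infinite value would be turned into 0.\<close>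

definition E :: "real \<Rightarrow> real" where "E y = enn2real (orlicz_dual M y)"

lemma orlicz_dual_E:
  assumes "0 \<le> y" "y \<le> 1"
  shows "orlicz_dual M y = ennreal (E y)"
proof -
  have "orlicz_dual M y \<le> 1" using orlicz_dual_mono[of y 1] norm assms by simp
  then have "orlicz_dual M y < top" using le_less_trans by fastforce
  then show ?thesis unfolding E_def by simp
qed

lemma k_has_integral:
  assumes y: "0 \<le> y" "y \<le> 1"
  shows "(k has_integral E y) {0..y}"
proof -
  have "((\<lambda>s. k s * indicator {0..y} s) has_integral E y) UNIV"
  proof (rule nn_integral_has_integral)
    show "(\<integral>\<^sup>+ s. ennreal (k s * indicator {0..y} s) \<partial>lborel) = ennreal (E y)"
      using orlicz_dual_k[OF y] orlicz_dual_E[OF y] by simp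
  qed (auto simp: k_nonneg E_def)
  moreover have "(\<lambda>s. k s * indicator {0..y} s) = (\<lambda>s. if s \<in> {0..y} then k s else 0)"
    by (auto simp: indicator_def)
  ultimately show ?thesis by (simp only: has_integral_restrict_UNIV)
qed

lemma E_eq: "0 \<le> y \<Longrightarrow> y \<le> 1 \<Longrightarrow> integral {0..y} k = E y"
  using k_has_integral by (rule integral_unique)

lemma E_0: "E 0 = 0" using E_eq[of 0] by simp
lemma E_1: "E 1 = 1" unfolding E_def norm by simp

lemma E_cont: "continuous_on {0..1} E"
proof -
  have "continuous_on {0..1} (\<lambda>y. integral {0..y} k)"
    by (rule indefinite_integral_continuous_1) (use k_has_integral[of 1] in auto)
  then show ?thesis by (rule continuous_on_eq) (simp add: E_eq)
qed

lemma E_deriv: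
  assumes y: "0 < y" "y < 1"
  shows "(E has_real_derivative \<iota> y) (at y)"
proof -
  have "isCont k y"
  proof -
    have "\<forall>\<^sub>F s in nhds y. s \<in> {0<..<1}" using y by (intro eventually_nhds_in_open) auto
    then have "\<forall>\<^sub>F s in nhds y. k s = \<iota> s" by eventually_elim (simp add: k_eq)
    then show ?thesis using \<iota>_isCont[OF y] isCont_cong by blast
  qed
  then have "((\<lambda>u. integral {0..u} k) has_vector_derivative k y) (at y within {0..1} - {})"
    using y k_has_integral[of 1]
    by (intro integral_has_vector_derivative_continuous_at) (auto intro: continuous_at_imp_continuous_at_within)
  then have "((\<lambda>u. integral {0..u} k) has_real_derivative k y) (at y)"
    using y at_within_Icc_at[of 0 y 1] by (simp add: has_real_derivative_iff_has_vector_derivative)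
  then show ?thesis
    by (rule has_field_derivative_transform_within_open[where S="{0<..<1}", THEN back_subst[of "\<lambda>d. (E has_real_derivative d) (at y)"]])
      (use y in \<open>auto simp: E_eq k_eq\<close>)
qed

lemma E_strict:
  assumes "0 \<le> x" "x < y" "y \<le> 1"
  shows "E x < E y"
proof (rule DERIV_pos_imp_increasing_open[OF assms(2)])
  show "\<exists>d. (E has_real_derivative d) (at u) \<and> 0 < d" if "x < u" "u < y" for u
    using E_deriv[of u] \<iota>_pos'[of u] that assms by auto
  show "continuous_on {x..y} E" by (rule continuous_on_subset[OF E_cont]) (use assms in auto)
qed

text \<open>Beyond 1 the integrand is at least \<open>\<iota> (1/2) > 0\<close>, possibly infinite,
  so the dual function strictly exceeds its value 1 at 1.\<close>

lemma orlicz_dual_le_1: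
  assumes "0 \<le> y" "orlicz_dual M y \<le> 1"
  shows "y \<le> 1"
proof (rule ccontr)
  assume "\<not> ?thesis"
  then have y: "1 < y" by simp
  define \<delta> where "\<delta> = \<iota> (1/2)"
  have \<delta>: "0 < \<delta>" unfolding \<delta>_def by (rule \<iota>_pos') auto
  have "1 < 1 + ennreal \<delta> * ennreal (y - 1)"
    using \<delta> y by (simp add: ennreal_mult[symmetric] ennreal_1[symmetric] ennreal_plus[symmetric] ennreal_less_iff del: ennreal_1 ennreal_plus)
  also have "\<dots> = (\<integral>\<^sup>+ s. ennreal (k s * indicator {0..1} s) \<partial>lborel)
      + (\<integral>\<^sup>+ s. ennreal \<delta> * indicator {1<..y} s \<partial>lborel)"
    using orlicz_dual_k[of 1] norm y by (simp add: nn_integral_cmult_indicator)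
  also have "\<dots> = (\<integral>\<^sup>+ s. ennreal (k s * indicator {0..1} s) + ennreal \<delta> * indicator {1<..y} s \<partial>lborel)"
    by (intro nn_integral_add[symmetric]) auto
  also have "\<dots> \<le> orlicz_dual M y"
    unfolding orlicz_dual_def
  proof (intro nn_integral_mono_AE)
    show "AE s in lborel. ennreal (k s * indicator {0..1} s) + ennreal \<delta> * indicator {1<..y} s
        \<le> inverse_deriv M s * indicator {0..\<bar>y\<bar>} s"
      using AE_inverse_deriv
    proof eventually_elim
      case (elim s)
      have "ennreal \<delta> \<le> inverse_deriv M s" if "1 < s"
        using \<iota>_strict[of "1/2" s] that
        by (auto simp: inverse_deriv_eq \<delta>_def intro: ennreal_leI[OF less_imp_le])
      then show ?case using elim y by (auto simp: indicator_def)
    qed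
  qed
  finally show False using assms by simp
qed

section \<open>The inverse of the dual function and its square\<close>

definition G :: "real \<Rightarrow> real" where "G = dual_inv M"

text \<open>\<open>inv_into\<close> picks some nonnegative preimage. By
  \<open>orlicz_dual_le_1\<close> it lies in \<open>[0, 1]\<close>, and there \<open>E\<close> is
  injective.\<close>

lemma G_E:
  assumes y: "0 \<le> y" "y \<le> 1"
  shows "G (E y) = y"
proof -
  have "orlicz_dual M y \<in> orlicz_dual M ` {0..}" using y by auto
  then have in': "ennreal (E y) \<in> orlicz_dual M ` {0..}" using orlicz_dual_E[OF y] by simp
  define z where "z = G (E y)"
  have z0: "0 \<le> z" and zE: "orlicz_dual M z = ennreal (E y)"
    unfolding z_def G_def dual_inv_def using inv_into_into[OF in'] f_inv_into_f[OF in'] by auto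
  have "ennreal (E y) \<le> 1" using orlicz_dual_mono[of y 1] norm y orlicz_dual_E[OF y] by simp
  then have z1: "z \<le> 1" using orlicz_dual_le_1[OF z0] zE by simp
  have "E z = E y" using zE unfolding E_def by simp
  then have "z = y"
    using E_strict[of z y] E_strict[of y z] z0 z1 y by (cases z y rule: linorder_cases) auto
  then show ?thesis by (simp add: z_def)
qed

lemma G_bounds:
  assumes "0 \<le> s" "s \<le> 1"
  shows "0 \<le> G s" "G s \<le> 1" "E (G s) = s"
proof -
  obtain y where "0 \<le> y" "y \<le> 1" "E y = s"
    using IVT'[of E 0 s 1] E_0 E_1 E_cont assms by auto
  then show "0 \<le> G s" "G s \<le> 1" "E (G s) = s" using G_E[of y] by auto
qed

lemma G_0: "G 0 = 0" using G_E[of 0] E_0 by simp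
lemma G_1: "G 1 = 1" using G_E[of 1] E_1 by simp

lemma G_strict:
  assumes "0 \<le> r" "r < t" "t \<le> 1"
  shows "G r < G t"
proof (rule ccontr)
  assume "\<not> ?thesis"
  then have "E (G t) \<le> E (G r)"
    using E_strict[of "G t" "G r"] G_bounds[of r] G_bounds[of t] assms by (cases "G t = G r") auto
  then show False using G_bounds[of r] G_bounds[of t] assms by simp
qed

lemma G_open: "0 < s \<Longrightarrow> s < 1 \<Longrightarrow> 0 < G s \<and> G s < 1"
  using G_strict[of 0 s] G_strict[of s 1] G_0 G_1 by simp

lemma G_cont: "continuous_on {0..1} G"
proof -
  have "continuous_on (E ` {0..1}) G"
    by (rule continuous_on_inv[OF E_cont]) (auto simp: G_E)
  moreover have "{0..1} \<subseteq> E ` {0..1}" using G_bounds by (metis atLeastAtMost_iff image_eqI subsetI)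
  ultimately show ?thesis by (rule continuous_on_subset)
qed

lemma G_deriv:
  assumes s: "0 < s" "s < 1"
  shows "(G has_real_derivative inverse (\<iota> (G s))) (at s)"
proof (rule DERIV_inverse_function[where f=E and a=0 and b=1])
  show "(E has_real_derivative \<iota> (G s)) (at (G s))" using G_open[OF s] by (intro E_deriv) auto
  show "\<iota> (G s) \<noteq> 0" using \<iota>_pos'[of "G s"] G_open[OF s] by auto
  show "isCont G s" using G_cont by (rule continuous_on_interior) (use s in simp)
qed (use s G_bounds in auto)

definition p :: "real \<Rightarrow> real" where "p s = 2 * G s / \<iota> (G s)"
definition N :: "real set" where "N = {t. 0 < t \<and> m t < 1 \<and> deriv m t = 0}"
text \<open>Corresponds to \<open>N\<close> under the substitution \<open>s = E (m t)\<close>; at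
  these points the inverse function theorem gives no derivative of \<open>\<iota>\<close>.\<close>

definition Z :: "real set" where "Z = {s. 0 < s \<and> s < 1 \<and> deriv m (\<iota> (G s)) = 0}"

lemma N_null: "negligible N"
proof -
  have "AE t in lborel. t \<notin> N"
    using regular unfolding dual_inv_sq_regular_def N_def m_def by eventually_elim auto
  then obtain N' where "N' \<in> null_sets lborel" "N \<subseteq> N'"
    by (auto simp: eventually_ae_filter)
  then show ?thesis
    using null_sets_completionI negligible_iff_null_sets negligible_subset by blast
qed

lemma differentiable_image_N:
  assumes "\<And>t. t \<in> N \<Longrightarrow> \<exists>d. (g has_real_derivative d) (at t)"
  shows "negligible (g ` N)"
proof (rule negligible_differentiable_image_negligible[OF _ N_null])
  show "g differentiable_on N"
    unfolding differentiable_on_def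
    using assms by (auto simp: real_differentiable_def) (meson has_field_derivative_at_within)
qed simp

lemma Z_N: "s \<in> Z \<Longrightarrow> \<iota> (G s) \<in> N \<and> m (\<iota> (G s)) = G s \<and> E (m (\<iota> (G s))) = s"
  using G_open[of s] \<iota>_pos'[of "G s"] m_\<iota>[of "G s"] G_bounds[of s] by (auto simp: Z_def N_def)

lemma Em_deriv: "t \<in> N \<Longrightarrow> ((\<lambda>t. E (m t)) has_real_derivative \<iota> (m t) * deriv m t) (at t)"
  by (rule DERIV_chain2[OF E_deriv m_deriv]) (auto simp: N_def m_pos)

text \<open>Both null set conditions on \<open>Z\<close> are checked in the variable
  \<open>t = \<iota> (G s)\<close>: the sets in question lie in images of the null set
  \<open>N\<close> under functions differentiable on it, although \<open>\<iota>\<close> itself has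
  no derivative to offer there.\<close>

sublocale concave_square "dual_inv_sq M" p Z
proof
  have f: "dual_inv_sq M = (\<lambda>s. (G s)\<^sup>2)" by (simp add: fun_eq_iff dual_inv_sq_def G_def)
  show "dual_inv_sq M 0 = 0" "dual_inv_sq M 1 = 1" unfolding f by (auto simp: G_0 G_1)
  show "continuous_on {0..1} (dual_inv_sq M)" unfolding f by (intro continuous_intros G_cont)
  show "negligible Z"
  proof (rule negligible_subset)
    show "negligible ((\<lambda>t. E (m t)) ` N)"
      by (rule differentiable_image_N) (use Em_deriv in blast)
    show "Z \<subseteq> (\<lambda>t. E (m t)) ` N"
    proof
      fix s assume "s \<in> Z"
      from Z_N[OF this] show "s \<in> (\<lambda>t. E (m t)) ` N" by (intro image_eqI[of _ _ "\<iota> (G s)"]) auto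
    qed
  qed
  show "negligible ((\<lambda>s. dual_inv_sq M s - s * p s) ` Z)"
  proof -
    \<comment> \<open>The function \<open>f - s f'\<close> after substituting
      \<open>G s = m t\<close> and \<open>s = E (m t)\<close>.\<close>
    define g where "g t = (m t)\<^sup>2 - E (m t) * (2 * m t / t)" for t
    have "(\<lambda>s. dual_inv_sq M s - s * p s) ` Z \<subseteq> g ` N"
    proof
      fix y assume "y \<in> (\<lambda>s. dual_inv_sq M s - s * p s) ` Z"
      then obtain s where s: "s \<in> Z" "y = (G s)\<^sup>2 - s * p s" unfolding f by auto
      have "m (\<iota> (G s)) = G s" "E (G s) = s" using Z_N[OF s(1)] by auto
      then have "y = g (\<iota> (G s))" using s(2) by (simp add: g_def p_def)
      then show "y \<in> g ` N" using Z_N[OF s(1)] by blast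
    qed
    moreover have "\<exists>d. (g has_real_derivative d) (at t)" if t: "t \<in> N" for t
    proof -
      have tp: "t \<noteq> 0" using t by (simp add: N_def)
      have "((\<lambda>t. (m t)\<^sup>2) has_real_derivative 2 * m t * deriv m t) (at t)"
        using m_deriv[of t] by (auto intro!: derivative_eq_intros)
      moreover have "((\<lambda>t. 2 * m t / t) has_real_derivative
          ((2 * deriv m t) * t - (2 * m t) * 1) / (t * t)) (at t)"
        by (intro DERIV_divide DERIV_cmult m_deriv DERIV_ident tp)
      ultimately show ?thesis
        unfolding g_def using DERIV_diff DERIV_mult[OF Em_deriv[OF t]] by blast
    qed
    ultimately show ?thesis using differentiable_image_N negligible_subset by blast
  qed
  show "Z \<subseteq> {0<..<1}" by (auto simp: Z_def)
  fix s :: real assume s: "0 < s" "s < 1"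
  have \<iota>s: "0 < \<iota> (G s)" using \<iota>_pos'[of "G s"] G_open[OF s] by auto
  have "((\<lambda>s. (G s)\<^sup>2) has_real_derivative 2 * G s * inverse (\<iota> (G s))) (at s)"
    using G_deriv[OF s] by (auto intro!: derivative_eq_intros)
  then show "(dual_inv_sq M has_real_derivative p s) (at s)"
    unfolding f p_def by (simp add: divide_inverse)
  show "0 < p s" unfolding p_def using G_open[OF s] \<iota>s by simp
  have Gc: "isCont G s" using G_deriv[OF s] by (rule DERIV_isCont)
  have \<iota>c: "isCont (\<lambda>s. \<iota> (G s)) s"
    using G_open[OF s] by (intro isCont_o2[OF Gc] \<iota>_isCont) auto
  show "isCont p s"
    unfolding p_def[abs_def] using \<iota>s by (intro continuous_intros Gc \<iota>c) auto
  show "p field_differentiable at s" if "s \<notin> Z"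
  proof -
    have nz: "deriv m (\<iota> (G s)) \<noteq> 0" using that s by (simp add: Z_def)
    have "(\<iota> has_real_derivative inverse (deriv m (\<iota> (G s)))) (at (G s))"
      by (rule DERIV_inverse_function[where f=m and a=0 and b=1])
        (use G_open[OF s] m_\<iota> \<iota>_isCont m_deriv nz in auto)
    then have "((\<lambda>s. \<iota> (G s)) has_real_derivative
        inverse (deriv m (\<iota> (G s))) * inverse (\<iota> (G s))) (at s)"
      using DERIV_chain2 G_deriv[OF s] by blast
    then have "(\<lambda>s. 2 * G s / \<iota> (G s)) field_differentiable at s"
      using G_deriv[OF s] \<iota>s unfolding field_differentiable_def
      by (intro exI) (auto intro!: derivative_intros)
    then show ?thesis by (simp add: p_def[abs_def])
  qed
next
  \<comment> \<open>With \<open>t = \<iota> (G s)\<close> the derivative of \<open>f\<close> is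
    \<open>2 * m t / t\<close>, so strict 2-concavity of \<open>M\<close> becomes strict concavity
    of \<open>f\<close>.\<close>
  fix r t :: real assume rt: "0 < r" "r < t" "t < 1"
  have G: "0 < G r" "G r < G t" "G t < 1" using G_open[of r] G_open[of t] G_strict[of r t] rt by auto
  have "\<iota> (G r) < \<iota> (G t)" using G by (intro \<iota>_strict unit_in_image) auto
  then have "m (\<iota> (G t)) / \<iota> (G t) < m (\<iota> (G r)) / \<iota> (G r)"
    using G \<iota>_pos'[of "G r"] by (intro m_ratio_strict) auto
  then show "p t < p r" unfolding p_def using G m_\<iota>[of "G r"] m_\<iota>[of "G t"] by simp
qed

section \<open>Transfer to the coefficients and the Orlicz norm\<close>

lemma coef_eq:
  assumes "l \<in> {1..n}"
  shows "coef M n l = cell_mean n l"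
proof -
  let ?I = "{(real l - 1) / real n..real l / real n}"
  have "integral ?I (coef_integrand M) = integral ?I a"
  proof (rule Henstock_Kurzweil_Integration.integral_cong)
    fix t assume "t \<in> ?I"
    moreover have "0 \<le> (real l - 1) / real n" using assms by auto
    ultimately have "0 \<le> t" by auto
    then show "coef_integrand M t = a t"
      using a_eq[of t] unfolding coef_integrand_def Let_def j_def[abs_def] by simp
  qed
  moreover have "(a has_integral (P (real l / real n) - P ((real l - 1) / real n))) ?I"
    by (rule a_has_integral) (use assms in \<open>auto simp: divide_right_mono\<close>)
  ultimately show ?thesis unfolding coef_def cell_mean_def by (simp add: integral_unique)
qed

lemma dual_inv_eq: "0 \<le> s \<Longrightarrow> s \<le> 1 \<Longrightarrow> sqrt (dual_inv_sq M s) = G s"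
  using G_bounds(1)[of s] by (simp add: dual_inv_sq_def G_def)

lemma orlicz_dual_abs: "orlicz_dual M \<bar>y\<bar> = orlicz_dual M y"
  by (simp add: orlicz_dual_def)

lemma perm_avg_coef: "perm_avg n (coef M n) x = perm_avg n (cell_mean n) (\<lambda>i. \<bar>x i\<bar>)"
  unfolding perm_avg_def
proof (intro arg_cong2[where f="(*)"] refl sum.cong arg_cong[where f=sqrt])
  fix \<pi> i assume "\<pi> \<in> {\<pi>. \<pi> permutes {1..n}}" "i \<in> {1..n}"
  then have "\<pi> i \<in> {1..n}" using permutes_in_image by fastforce
  then show "\<bar>x i * coef M n (\<pi> i)\<bar>\<^sup>2 = \<bar>\<bar>x i\<bar> * cell_mean n (\<pi> i)\<bar>\<^sup>2"
    by (simp add: coef_eq power_mult_distrib)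
qed

lemma zero_extend_pairing: "(\<Sum>i. zero_extend n x i * y i) = (\<Sum>i=1..n. x i * y i)"
  by (subst suminf_finite[of "{1..n}"]) (auto simp: zero_extend_def)

text \<open>With \<open>s i = E \<bar>y i\<bar>\<close> the constraint on \<open>y\<close> becomes
  that the \<open>s i\<close> sum to at most 1, and \<open>\<bar>y i\<bar>\<close> is the square
  root of \<open>f\<close> at \<open>s i\<close>.\<close>

lemma pairing_le:
  assumes n: "n \<ge> 1" and y: "(\<Sum>i. orlicz_dual M (y i)) \<le> 1"
  shows "(\<Sum>i=1..n. x i * y i) \<le> 6 * perm_avg n (coef M n) x"
proof -
  define s where "s i = E \<bar>y i\<bar>" for i
  have "orlicz_dual M (y i) \<le> 1" for i
    using sum_le_suminf[of "\<lambda>i. orlicz_dual M (y i)" "{i}"] y by (auto intro: order_trans)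
  then have y1: "\<bar>y i\<bar> \<le> 1" for i
    by (intro orlicz_dual_le_1) (auto simp: orlicz_dual_abs)
  have s0: "0 \<le> s i" for i unfolding s_def E_def by simp
  have "ennreal (\<Sum>i=1..n. s i) = (\<Sum>i=1..n. ennreal (s i))"
    by (rule sum_ennreal[symmetric]) (rule s0)
  also have "\<dots> = (\<Sum>i=1..n. orlicz_dual M (y i))"
    using orlicz_dual_E[of "\<bar>y i\<bar>" for i] y1 by (simp add: s_def orlicz_dual_abs)
  also have "\<dots> \<le> 1"
    using sum_le_suminf[of "\<lambda>i. orlicz_dual M (y i)" "{1..n}"] y by (auto intro: order_trans)
  finally have ssum: "(\<Sum>i=1..n. s i) \<le> 1" by simp
  have ys: "sqrt (dual_inv_sq M (s i)) = \<bar>y i\<bar>" if "i \<in> {1..n}" for i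
  proof -
    have "s i \<le> (\<Sum>i=1..n. s i)" by (rule member_le_sum) (use that s0 in auto)
    then show ?thesis
      using dual_inv_eq[of "s i"] G_E[of "\<bar>y i\<bar>"] y1[of i] s0[of i] ssum by (simp add: s_def)
  qed
  have "(\<Sum>i=1..n. x i * y i) \<le> (\<Sum>i=1..n. \<bar>x i\<bar> * sqrt (dual_inv_sq M (s i)))"
    by (intro sum_mono) (metis ys abs_mult abs_ge_self)
  also have "\<dots> \<le> 6 * perm_avg n (cell_mean n) (\<lambda>i. \<bar>x i\<bar>)"
    by (rule sum_le_perm_avg) (use n s0 ssum in auto)
  finally show ?thesis by (simp add: perm_avg_coef)
qed

lemma zero_feasible: "(\<Sum>i. orlicz_dual M ((\<lambda>_::nat. 0) i)) \<le> 1"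
  using orlicz_dual_E[of 0] E_0 by simp

text \<open>Ensures that the real supremum in \<open>orlicz_norm\<close> is a genuine one; the bound
  is the permutation average itself.\<close>

lemma norm_bdd:
  assumes "n \<ge> 1"
  shows "bdd_above ((\<lambda>y. \<Sum>i. zero_extend n x i * y i) ` {y. (\<Sum>i. orlicz_dual M (y i)) \<le> 1})"
  by (rule bdd_aboveI2[of _ _ "6 * perm_avg n (coef M n) x"])
    (use pairing_le[OF assms] in \<open>auto simp: zero_extend_pairing\<close>)

theorem orlicz_norm_le_perm_avg:
  assumes "n \<ge> 1"
  shows "orlicz_norm M (zero_extend n x) \<le> 6 * perm_avg n (coef M n) x"
  unfolding orlicz_norm_def
  by (rule cSUP_least) (use zero_feasible pairing_le[OF assms] in \<open>auto simp: zero_extend_pairing\<close>)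

lemma pairing_le_norm:
  assumes "n \<ge> 1" "(\<Sum>i. orlicz_dual M (y i)) \<le> 1"
  shows "(\<Sum>i=1..n. x i * y i) \<le> orlicz_norm M (zero_extend n x)"
  using cSUP_upper[OF _ norm_bdd[OF assms(1)], of y x] assms(2)
  by (simp add: orlicz_norm_def zero_extend_pairing)

lemma orlicz_norm_nonneg: "n \<ge> 1 \<Longrightarrow> 0 \<le> orlicz_norm M (zero_extend n x)"
  using pairing_le_norm[OF _ zero_feasible, of n x] by simp

theorem perm_avg_le_orlicz_norm:
  assumes n: "n \<ge> 1"
  shows "perm_avg n (coef M n) x \<le> 4 * orlicz_norm M (zero_extend n x)"
  unfolding perm_avg_coef
proof (rule perm_avg_le_of_bound[OF n])
  fix s :: "nat \<Rightarrow> real"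
  assume s: "\<And>i. i \<in> {1..n} \<Longrightarrow> 0 \<le> s i" "(\<Sum>i=1..n. s i) \<le> 1"
  have s1: "s i \<le> 1" if "i \<in> {1..n}" for i
    using member_le_sum[of i "{1..n}" s] that s by simp
  \<comment> \<open>Inverts the dual function coordinatewise and adopts the signs of
    \<open>x\<close>, so that the pairing with \<open>x\<close> has only nonnegative terms.\<close>
  define y where "y i = (if i \<in> {1..n} then (if 0 \<le> x i then G (s i) else - G (s i)) else 0)" for i
  have dual: "orlicz_dual M (y i) = ennreal (s i)" if "i \<in> {1..n}" for i
  proof -
    have "\<bar>y i\<bar> = G (s i)" using G_bounds(1)[OF s(1)[OF that] s1[OF that]] that by (simp add: y_def)
    then show ?thesis
      using orlicz_dual_E[of "G (s i)"] G_bounds[OF s(1)[OF that] s1[OF that]]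
        orlicz_dual_abs[of "y i"] by simp
  qed
  have "(\<Sum>i. orlicz_dual M (y i)) = (\<Sum>i=1..n. orlicz_dual M (y i))"
    using orlicz_dual_E[of 0] E_0 by (intro suminf_finite) (auto simp: y_def)
  also have "\<dots> = (\<Sum>i=1..n. ennreal (s i))" by (intro sum.cong refl dual)
  also have "\<dots> = ennreal (\<Sum>i=1..n. s i)" by (rule sum_ennreal) (rule s(1))
  also have "\<dots> \<le> 1" using s by simp
  finally have feas: "(\<Sum>i. orlicz_dual M (y i)) \<le> 1" .
  have "(\<Sum>i=1..n. \<bar>x i\<bar> * sqrt (dual_inv_sq M (s i))) = (\<Sum>i=1..n. x i * y i)"
    by (intro sum.cong refl) (use dual_inv_eq s(1) s1 in \<open>auto simp: y_def\<close>)
  also have "\<dots> \<le> orlicz_norm M (zero_extend n x)" by (rule pairing_le_norm[OF n feas])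
  finally show "(\<Sum>i=1..n. \<bar>x i\<bar> * sqrt (dual_inv_sq M (s i))) \<le> orlicz_norm M (zero_extend n x)" .
qed simp

end

theorem theorem2:
  shows "\<exists>c::real. c > 0 \<and>
    (\<forall>(n::nat) (M::real \<Rightarrow> real).
       n \<ge> 1 \<longrightarrow>
       orlicz_function M \<longrightarrow>
       strictly_convex_on UNIV M \<longrightarrow>
       twice_differentiable M \<longrightarrow>
       strictly_2_concave M \<longrightarrow>
       orlicz_dual M 1 = 1 \<longrightarrow>
       dual_inv_sq_regular M \<longrightarrow>
       (\<forall>x::nat \<Rightarrow> real.
          (1 / c) * orlicz_norm M (zero_extend n x)
            \<le> (1 / fact n) *
               (\<Sum>\<pi> | \<pi> permutes {1..n}. sqrt (\<Sum>i=1..n. \<bar>x i * coef M n (\<pi> i)\<bar>\<^sup>2)) \<and>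
          (1 / fact n) *
               (\<Sum>\<pi> | \<pi> permutes {1..n}. sqrt (\<Sum>i=1..n. \<bar>x i * coef M n (\<pi> i)\<bar>\<^sup>2))
            \<le> c * orlicz_norm M (zero_extend n x)))"
proof (intro exI[of _ 6] conjI allI impI)
  fix n :: nat and M :: "real \<Rightarrow> real" and x :: "nat \<Rightarrow> real"
  assume n: "n \<ge> 1" and "orlicz_function M" "strictly_convex_on UNIV M" "twice_differentiable M"
    "strictly_2_concave M" "orlicz_dual M 1 = 1" "dual_inv_sq_regular M"
  then interpret two_concave_orlicz M by unfold_locales
  have "(1 / 6) * orlicz_norm M (zero_extend n x) \<le> perm_avg n (coef M n) x"
    using orlicz_norm_le_perm_avg[OF n, of x] by simp
  then show "(1 / 6) * orlicz_norm M (zero_extend n x)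
      \<le> (1 / fact n) *
         (\<Sum>\<pi> | \<pi> permutes {1..n}. sqrt (\<Sum>i=1..n. \<bar>x i * coef M n (\<pi> i)\<bar>\<^sup>2))"
    unfolding perm_avg_def .
  \<comment> \<open>The constant 4 is enlarged to 6, which uses that the norm is
    nonnegative.\<close>
  show "(1 / fact n) *
         (\<Sum>\<pi> | \<pi> permutes {1..n}. sqrt (\<Sum>i=1..n. \<bar>x i * coef M n (\<pi> i)\<bar>\<^sup>2))
      \<le> 6 * orlicz_norm M (zero_extend n x)"
    using perm_avg_le_orlicz_norm[OF n, of x] orlicz_norm_nonneg[OF n, of x]
    unfolding perm_avg_def by simp
qed simp

end
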